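(* Let $\mathcal{X}=\mathrm{iid}(\{\pm1\})$ be the i.i.d. Rademacher prior, with rate function $f_{\mathcal{X}}$. Let $0<\gamma\le\frac13$ and let $\beta\in\mathbb{R}$ satisfy $\beta^2<\gamma$. Then $f_{\mathcal{X}}(t)>\frac{-1}{2\gamma}\log(1-\beta^2t)$ for all $t\in(0,1)$, and $\mathrm{Wish}(\gamma,\beta,\mathrm{iid}(\{\pm1\}))$ is contiguous to $\mathrm{Wish}(\gamma)$.
   Context: $\mathrm{iid}(\{\pm1\})$ is the family of distributions $\{\mathcal{X}_n\}$ in which the coordinates of $x\in\mathbb{R}^n$ are independent and uniform on $\{+1/\sqrt n,-1/\sqrt n\}$. Its rate function is the pointwise limit $$f_{\mathcal{X}}(t)=\lim_{n\to\infty}-\frac1n\log\Pr_{x,x'\sim\mathcal{X}_n}[\langle x,x'\rangle^2\ge t],$$ with $x,x'$ independent (this limit exists; for $t\in(0,1)$ it equals $\frac12(1+\sqrt t)\log(1+\sqrt t)+\frac12(1-\sqrt t)\log(1-\sqrt t)$). The spiked Wishart model $\mathrm{Wish}(\gamma,\beta,\mathcal{X})$: draw $x\sim\mathcal{X}_n$ and reveal the $n\times n$ matrix $Y=XX^\top$, where $X$ is an $n\times N$ matrix whose columns are, conditionally on $x$, independent samples from $\mathcal{N}(0,I_n+\beta xx^\top)$; here $N=N(n)$ with $n/N\to\gamma$ as $n\to\infty$. $\mathrm{Wish}(\gamma)$ is the unspiked case $\beta=0$ (same $N$). Contiguity: for sequences of probability measures $P_n,Q_n$ on measurable spaces $(\Omega_n,\mathcal{F}_n)$,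 $P_n$ is contiguous to $Q_n$ if for every sequence of events $A_n\in\mathcal{F}_n$, $Q_n(A_n)\to0$ implies $P_n(A_n)\to0$ as $n\to\infty$. *)

theory Defs
  imports
    "HOL-Probability.Probability"
    "Jordan_Normal_Form.Gauss_Jordan_Elimination"
    "Jordan_Normal_Form.Determinant"
begin

text \<open>
  Since the dimension \<open>n\<close> varies along the sequences below, a vector in \<open>\<real>\<^sup>n\<close> is an element of the
  product space over the index set \<open>{..<n}\<close>, and an \<open>n \<times> n\<close> matrix (as an observation) an element
  of the product space over \<open>{..<n} \<times> {..<n}\<close>. A prior, i.e. a family of distributions with one
  member on each \<open>\<real>\<^sup>n\<close>, has type \<open>nat \<Rightarrow> (nat \<Rightarrow> real) measure\<close>.

  In qualified names, \<open>Matrix\<close> and \<open>Determinant\<close> refer to Jordan\_Normal\_Form, whose matrices carry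
  their dimensions as values; the unqualified names would clash with those of HOL-Analysis.
\<close>

text \<open>
  The underlying space of the prior is the finite set of sign vectors, with all subsets measurable.
  In particular every function on it is measurable.
\<close>

definition iid_rademacher :: "nat \<Rightarrow> (nat \<Rightarrow> real) measure" where
  "iid_rademacher n =
     PiM {..<n} (\<lambda>_. uniform_count_measure {1 / sqrt (real n), - (1 / sqrt (real n))})"

text \<open>
  The limit is taken in the reals, so this is the rate function at those \<open>t\<close> where it is finite;
  because of \<open>ln 0 = 0\<close> it must not be used at \<open>t\<close> where the probabilities vanish
  (here: \<open>t > 1\<close>).
\<close>

definition rate_function :: "(nat \<Rightarrow> (nat \<Rightarrow> real) measure) \<Rightarrow> real \<Rightarrow> real" where
  "rate_function \<X> t =
     lim (\<lambda>n. - (1 / real n) *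
       ln (measure (\<X> n \<Otimes>\<^sub>M \<X> n)
             {(x, x') \<in> space (\<X> n \<Otimes>\<^sub>M \<X> n). (\<Sum>i<n. x i * x' i)\<^sup>2 \<ge> t}))"

text \<open>
  The centred normal distribution on \<open>\<real>\<^sup>n\<close>, given by its Lebesgue density; the covariance matrix
  \<open>\<Sigma>\<close> is meant to be symmetric and positive definite.
\<close>

definition mv_normal :: "nat \<Rightarrow> real Matrix.mat \<Rightarrow> (nat \<Rightarrow> real) measure" where
  "mv_normal n \<Sigma> =
     density (PiM {..<n} (\<lambda>_. lborel)) (\<lambda>v.
       ennreal (exp (- (1 / 2) *
           Matrix.scalar_prod (Matrix.vec n v) (the (mat_inverse \<Sigma>) *\<^sub>v Matrix.vec n v)) /
         sqrt ((2 * pi) ^ n * Determinant.det \<Sigma>)))"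

definition spiked_covariance :: "nat \<Rightarrow> real \<Rightarrow> (nat \<Rightarrow> real) \<Rightarrow> real Matrix.mat" where
  "spiked_covariance n \<beta> x = 1\<^sub>m n + \<beta> \<cdot>\<^sub>m Matrix.mat n n (\<lambda>(i, j). x i * x j)"

text \<open>
  The law of \<open>X X\<^sup>T\<close>, where \<open>X\<close> has \<open>N\<close> independent columns \<open>X 0, \<dots>, X (N - 1)\<close> with
  distribution \<open>mv_normal n \<Sigma>\<close>; note that \<open>X k i\<close> is the entry in row \<open>i\<close> and column \<open>k\<close>.
\<close>

definition gram_law :: "nat \<Rightarrow> nat \<Rightarrow> real Matrix.mat \<Rightarrow> (nat \<times> nat \<Rightarrow> real) measure" where
  "gram_law n N \<Sigma> =
     distr (PiM {..<N} (\<lambda>_. mv_normal n \<Sigma>)) (PiM ({..<n} \<times> {..<n}) (\<lambda>_. borel))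
       (\<lambda>X. \<lambda>(i, j) \<in> {..<n} \<times> {..<n}. \<Sum>k<N. X k i * X k j)"

text \<open>
  The parameter \<open>\<gamma>\<close> of the Wishart models is the limit of \<open>n / N n\<close>, hence it does not occur in the
  measures themselves; the sample size \<open>N\<close> does instead.
\<close>

definition spiked_wishart ::
  "(nat \<Rightarrow> nat) \<Rightarrow> real \<Rightarrow> (nat \<Rightarrow> (nat \<Rightarrow> real) measure) \<Rightarrow> nat \<Rightarrow> (nat \<times> nat \<Rightarrow> real) measure" where
  "spiked_wishart N \<beta> \<X> n = \<X> n \<bind> (\<lambda>x. gram_law n (N n) (spiked_covariance n \<beta> x))"

definition wishart :: "(nat \<Rightarrow> nat) \<Rightarrow> nat \<Rightarrow> (nat \<times> nat \<Rightarrow> real) measure" where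
  "wishart N n = gram_law n (N n) (1\<^sub>m n)"

definition contiguous_to :: "(nat \<Rightarrow> 'a measure) \<Rightarrow> (nat \<Rightarrow> 'a measure) \<Rightarrow> bool" where
  "contiguous_to P Q \<longleftrightarrow>
     (\<forall>n. prob_space (P n) \<and> prob_space (Q n) \<and> sets (P n) = sets (Q n)) \<and>
     (\<forall>A. (\<forall>n. A n \<in> sets (Q n)) \<longrightarrow>
        (\<lambda>n. measure (Q n) (A n)) \<longlonglongrightarrow> 0 \<longrightarrow> (\<lambda>n. measure (P n) (A n)) \<longlonglongrightarrow> 0)"

end

theory Submission
  imports Defs "HOL-Real_Asymp.Real_Asymp"
begin

text \<open>
  Write \<open>I s = ((1 + s) ln (1 + s) + (1 - s) ln (1 - s)) / 2\<close>. The inner product \<open>\<rho>\<close> of two independent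
  sign vectors is a normalised simple random walk, so Chernoff's bound and the size of the largest
  binomial term identify the rate function as \<open>I (sqrt t)\<close>. Comparing second derivatives gives
  \<open>I s \<ge> - ln (1 - d s\<^sup>2) / (2 d)\<close> for \<open>d \<le> 1 / 3\<close>, which for \<open>d = \<beta>\<^sup>2\<close> is the claimed inequality up to
  the factor \<open>\<beta>\<^sup>2 / \<gamma> < 1\<close>.

  For contiguity, the likelihood ratio of the data \<open>X\<close> has second moment
  \<open>E (1 - \<beta>\<^sup>2 \<rho>\<^sup>2) powr (- N / 2)\<close>, a Gaussian integral with a rank two perturbation of the identity. The same
  inequality bounds it by \<open>E exp (c n I \<bar>\<rho>\<bar>)\<close> with \<open>c < 1\<close> for large \<open>n\<close>, and this is bounded in \<open>n\<close>
  because \<open>P (n I \<bar>\<rho>\<bar> \<ge> y) \<le> 2 exp (- y)\<close>.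
\<close>

section \<open>The rate function of a random walk\<close>

text \<open>The bound 1/3 comes from the fourth order at 0: the rate is s^2/2 + s^4/12 + ..., the
  logarithmic expression is s^2/2 + d s^4/4 + ..., so their comparison fails near 0 as soon as d >
  1/3. Since the second order terms agree, the comparison leaves no room near 0, and the slack in
  both conclusions comes from \<beta>^2 < \<gamma>. In the second moment this slack must also absorb
  that n / N merely converges to \<gamma>; there \<gamma> is replaced by some g strictly between
  \<beta>^2 and \<gamma>, and c = \<beta>^2 / g. The tail bound is uniform in n and phrased in the
  variable n I \<bar>\<rho>\<bar> itself, so small and large deviations of \<rho> are handled by one
  estimate. The likelihood ratio is formed for X and not for the observed matrix: an event for
  \<open>X X\<^sup>T\<close> pulls back to an event for X, so the density of a Wishart matrix never
  has to be computed.\<close>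

definition rademacher_rate :: "real \<Rightarrow> real" where
  "rademacher_rate s = ((1 + s) * ln (1 + s) + (1 - s) * ln (1 - s)) / 2"

text \<open>At s = 1 the product 0 * ln 0 is 0, which is also the limit of (1 - s) ln (1 - s). The
  endpoint matters because it is attained by equal or opposite sign vectors.\<close>

lemma tendsto_rademacher_rate_at_1: "(rademacher_rate \<longlongrightarrow> rademacher_rate 1) (at_left 1)"
proof -
  have "(rademacher_rate \<longlongrightarrow> ln 2) (at_left 1)"
    unfolding rademacher_rate_def by real_asymp
  then show ?thesis by (simp add: rademacher_rate_def)
qed

section \<open>Comparison of the rate with a logarithm\<close>

lemma rademacher_rate_lower_bound:
  fixes d s :: real
  assumes d: "0 < d" "d \<le> 1 / 3" and s: "0 \<le> s" "s \<le> 1"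
  shows "- ln (1 - d * s\<^sup>2) / (2 * d) \<le> rademacher_rate s"
proof -
  \<comment> \<open>Both \<open>h\<close> and its derivative \<open>h1\<close> vanish at 0, so it
    suffices that the second derivative is nonnegative on [0, 1).\<close>
  define h where "h u = rademacher_rate u + ln (1 - d * u\<^sup>2) / (2 * d)" for u
  define h1 where "h1 u = (ln (1 + u) - ln (1 - u)) / 2 - u / (1 - d * u\<^sup>2)" for u
  have pos: "1 - d * u\<^sup>2 > 0" if "0 \<le> u" "u \<le> 1" for u
  proof -
    have "d * u\<^sup>2 \<le> 1 / 3 * 1"
      using d that by (intro mult_mono) (auto simp: power_le_one)
    then show ?thesis by simp
  qed
  have dh1: "(h1 has_real_derivative 1 / (1 - u\<^sup>2) - (1 + d * u\<^sup>2) / (1 - d * u\<^sup>2)\<^sup>2) (at u)"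
    if "0 \<le> u" "u < 1" for u
  proof -
    have p: "1 - d * u\<^sup>2 \<noteq> 0" and q: "1 + u > 0" "1 - u > 0" using pos[of u] that by auto
    have e1: "(1 / (1 + u) + 1 / (1 - u)) / 2 = 1 / (1 - u\<^sup>2)"
    proof -
      have "1 - u\<^sup>2 = (1 + u) * (1 - u)" by (simp add: power2_eq_square algebra_simps)
      then show ?thesis using q by (simp only: add_frac_eq) simp
    qed
    have e2: "(1 * (1 - d * u\<^sup>2) - u * (- (d * (2 * u)))) / ((1 - d * u\<^sup>2) * (1 - d * u\<^sup>2))
        = (1 + d * u\<^sup>2) / (1 - d * u\<^sup>2)\<^sup>2"
      by (simp add: power2_eq_square algebra_simps)
    have "((\<lambda>u. ln (1 + u)) has_real_derivative 1 / (1 + u)) (at u)"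
      "((\<lambda>u. ln (1 - u)) has_real_derivative - 1 / (1 - u)) (at u)"
      using q by (auto intro!: derivative_eq_intros)
    moreover have "((\<lambda>u. u / (1 - d * u\<^sup>2)) has_real_derivative (1 + d * u\<^sup>2) / (1 - d * u\<^sup>2)\<^sup>2) (at u)"
      unfolding e2[symmetric] using p by (auto intro!: derivative_eq_intros)
    ultimately have "(h1 has_real_derivative (1 / (1 + u) - - 1 / (1 - u)) / 2 - (1 + d * u\<^sup>2) / (1 - d * u\<^sup>2)\<^sup>2) (at u)"
      unfolding h1_def by (intro DERIV_diff DERIV_cdivide)
    then show ?thesis using e1 by simp
  qed
  have dh: "(h has_real_derivative h1 u) (at u)" if "0 \<le> u" "u < 1" for u
  proof -
    have p: "1 - d * u\<^sup>2 > 0" and q: "1 + u > 0" "1 - u > 0" using pos[of u] that by auto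
    have "((\<lambda>u. (1 + u) * ln (1 + u)) has_real_derivative ln (1 + u) + 1) (at u)"
      "((\<lambda>u. (1 - u) * ln (1 - u)) has_real_derivative - ln (1 - u) - 1) (at u)"
      using q by (auto intro!: derivative_eq_intros)
    moreover have "((\<lambda>u. ln (1 - d * u\<^sup>2) / (2 * d)) has_real_derivative - u / (1 - d * u\<^sup>2)) (at u)"
      using p d by (auto intro!: derivative_eq_intros)
    ultimately have "(h has_real_derivative
        ((ln (1 + u) + 1) + (- ln (1 - u) - 1)) / 2 + - u / (1 - d * u\<^sup>2)) (at u)"
      unfolding h_def rademacher_rate_def by (intro DERIV_add DERIV_cdivide)
    then show ?thesis by (simp add: h1_def)
  qed
  have second: "0 \<le> 1 / (1 - u\<^sup>2) - (1 + d * u\<^sup>2) / (1 - d * u\<^sup>2)\<^sup>2" if u: "0 \<le> u" "u < 1" for u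
  proof -
    \<comment> \<open>The numerator left after clearing denominators; its lowest order coefficient 1
      - 3 d is where d \<le> 1/3 enters.\<close>
    have "(1 - d * u\<^sup>2)\<^sup>2 - (1 + d * u\<^sup>2) * (1 - u\<^sup>2) = (1 - 3 * d) * u\<^sup>2 + (d\<^sup>2 + d) * (u\<^sup>2)\<^sup>2"
      by (simp add: algebra_simps power2_eq_square)
    moreover have "\<dots> \<ge> 0" using d by (intro add_nonneg_nonneg mult_nonneg_nonneg) auto
    moreover have "1 - u\<^sup>2 > 0" using u by (simp add: abs_square_less_1)
    ultimately show ?thesis using pos[of u] u by (simp add: divide_simps)
  qed
  have h1: "0 \<le> h1 u" if u: "0 \<le> u" "u < 1" for u
  proof -
    have "h1 0 \<le> h1 u"
    proof (rule DERIV_nonneg_imp_nondecreasing[OF u(1)])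
      fix x assume "0 \<le> x" "x \<le> u"
      with u show "\<exists>y. (h1 has_real_derivative y) (at x) \<and> 0 \<le> y"
        using dh1[of x] second[of x] by auto
    qed
    then show ?thesis by (simp add: h1_def)
  qed
  have h: "0 \<le> h u" if u: "0 \<le> u" "u < 1" for u
  proof -
    have "h 0 \<le> h u"
    proof (rule DERIV_nonneg_imp_nondecreasing[OF u(1)])
      fix x assume "0 \<le> x" "x \<le> u"
      with u show "\<exists>y. (h has_real_derivative y) (at x) \<and> 0 \<le> y"
        using dh[of x] h1[of x] by auto
    qed
    then show ?thesis by (simp add: h_def rademacher_rate_def)
  qed
  \<comment> \<open>The derivatives exist only below 1, so at s = 1 the value is obtained as a left
    limit of nonnegative ones.\<close>
  have "0 \<le> h s"
  proof (cases "s = 1")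
    case True
    have "1 - d * 1\<^sup>2 \<noteq> 0" using d by auto
    then have "(h \<longlongrightarrow> h 1) (at_left 1)"
      unfolding h_def using d
      by (intro tendsto_intros tendsto_rademacher_rate_at_1) auto
    moreover have "\<forall>\<^sub>F u in at_left 1. 0 \<le> h u"
      using eventually_at_left_real[of 0 "1::real"]
      by (auto elim!: eventually_mono intro!: h)
    ultimately show ?thesis using True tendsto_lowerbound by fastforce
  qed (use h s in auto)
  then show ?thesis by (simp add: h_def)
qed

text \<open>The logarithmic bound with d = 1/3 is already positive. This positivity makes the final
  inequality strict.\<close>

lemma rademacher_rate_pos:
  assumes "0 < s" "s \<le> 1"
  shows "0 < rademacher_rate s"
proof -
  have "s\<^sup>2 \<le> 1" "0 < s\<^sup>2" using assms by (auto simp: power_le_one)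
  then have "0 < - ln (1 - 1 / 3 * s\<^sup>2)" by (simp add: ln_less_zero)
  also have "- ln (1 - 1 / 3 * s\<^sup>2) / (2 * (1 / 3)) \<le> rademacher_rate s"
    using assms by (intro rademacher_rate_lower_bound) auto
  ultimately show ?thesis by simp
qed

lemma rademacher_rate_nonneg:
  assumes "0 \<le> s" "s \<le> 1"
  shows "0 \<le> rademacher_rate s"
  using rademacher_rate_pos[of s] assms by (cases "s = 0") (auto simp: rademacher_rate_def)

text \<open>The comparison with d = \<beta>^2, multiplied by \<beta>^2 / g; as it divides by d, the
  case \<beta> = 0 is separate. It serves with g = \<gamma> for the rate inequality and with g <
  \<gamma> for the second moment.\<close>

lemma scaled_ln_le_rademacher_rate:
  fixes \<beta> g s :: real
  assumes "0 < g" "\<beta>\<^sup>2 \<le> 1 / 3" "0 \<le> s" "s \<le> 1"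
  shows "- ln (1 - \<beta>\<^sup>2 * s\<^sup>2) / (2 * g) \<le> \<beta>\<^sup>2 / g * rademacher_rate s"
proof (cases "\<beta> = 0")
  case False
  then have "- ln (1 - \<beta>\<^sup>2 * s\<^sup>2) / (2 * \<beta>\<^sup>2) \<le> rademacher_rate s"
    using assms by (intro rademacher_rate_lower_bound) auto
  then have "\<beta>\<^sup>2 / g * (- ln (1 - \<beta>\<^sup>2 * s\<^sup>2) / (2 * \<beta>\<^sup>2)) \<le> \<beta>\<^sup>2 / g * rademacher_rate s"
    using assms by (intro mult_left_mono) auto
  then show ?thesis using False assms by simp
qed simp

section \<open>Chernoff's bound for binomial coefficients\<close>

text \<open>The unnormalised moment generating function of a walk with n steps \<plusminus>1, of
  which k go up.\<close>

lemma sum_choose_exp: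
  fixes u :: real
  shows "(\<Sum>k\<le>n. real (n choose k) * exp (u * (2 * real k - real n))) = (exp u + exp (- u)) ^ n"
proof -
  have "exp u ^ k * exp (- u) ^ (n - k) = exp (u * (2 * real k - real n))" if "k \<le> n" for k
    using that by (simp add: exp_of_nat_mult[symmetric] mult_exp_exp of_nat_diff algebra_simps)
  then show ?thesis
    by (auto simp: binomial_ring mult.assoc intro!: sum.cong)
qed

lemma binomial_tail_le:
  fixes s :: real
  assumes s: "0 \<le> s" "s \<le> 1"
  shows "(\<Sum>k | k \<le> n \<and> s * real n \<le> \<bar>2 * real k - real n\<bar>. real (n choose k))
           \<le> 2 * 2 ^ n * exp (- real n * rademacher_rate s)" (is "sum _ ?A \<le> _")
proof (cases "s = 1")
  case True
  \<comment> \<open>At s = 1 the optimal Chernoff parameter is infinite, but only the two extreme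
    coefficients remain to be counted.\<close>
  have "?A \<subseteq> {0, n}" using True by (auto simp: abs_if split: if_splits)
  then have "(\<Sum>k\<in>?A. real (n choose k)) \<le> (\<Sum>k\<in>{0, n}. real (n choose k))"
    by (intro sum_mono2) auto
  also have "\<dots> \<le> 2" by (cases "n = 0") auto
  also have "2 = 2 * 2 ^ n * exp (- real n * ln 2)"
    by (simp add: exp_minus exp_of_nat_mult)
  finally show ?thesis using True by (simp add: rademacher_rate_def)
next
  case False
  with s have p: "1 + s > 0" "1 - s > 0" by auto
  \<comment> \<open>\<open>u\<close> is artanh s, the optimal Chernoff parameter, and
    \<open>exp (- v)\<close> is cosh u. Hence u s + v = u s - ln (cosh u) is the Legendre transform
    of ln cosh at s.\<close>
  define u where "u = (ln (1 + s) - ln (1 - s)) / 2"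
  define v where "v = (ln (1 + s) + ln (1 - s)) / 2"
  have u: "0 \<le> u" using p s by (simp add: u_def)
  have "u = ln (1 + s) - v" "- u = ln (1 - s) - v" by (simp_all add: u_def v_def field_simps)
  then have "exp u = (1 + s) * exp (- v)" "exp (- u) = (1 - s) * exp (- v)"
    using p by (simp_all only: diff_conv_add_uminus exp_add exp_ln)
  then have uv: "exp u + exp (- u) = 2 * exp (- v)" by (simp add: algebra_simps)
  \<comment> \<open>Adding the weights for u and - u covers both tails at once and produces the
    factor 2.\<close>
  let ?e = "\<lambda>u k. real (n choose k) * exp (u * (2 * real k - real n))"
  have "(\<Sum>k\<in>?A. real (n choose k)) \<le> (\<Sum>k\<in>?A. exp (- u * s * n) * (?e u k + ?e (- u) k))"
  proof (intro sum_mono)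
    fix k assume k: "k \<in> ?A"
    have "1 \<le> exp (u * (\<bar>2 * real k - real n\<bar> - s * n))"
      using k u by simp
    also have "\<dots> = exp (- u * s * n) * exp (u * \<bar>2 * real k - real n\<bar>)"
      by (simp add: mult_exp_exp algebra_simps)
    also have "\<dots> \<le> exp (- u * s * n) *
        (exp (u * (2 * real k - real n)) + exp (- u * (2 * real k - real n)))"
      by (intro mult_left_mono) (cases "2 * real k < real n"; simp add: abs_if algebra_simps)+
    finally have "real (n choose k) * 1 \<le> real (n choose k) * (exp (- u * s * n) *
        (exp (u * (2 * real k - real n)) + exp (- u * (2 * real k - real n))))"
      by (intro mult_left_mono) auto
    then show "real (n choose k) \<le> exp (- u * s * n) * (?e u k + ?e (- u) k)"
      by (simp add: algebra_simps)
  qed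
  also have "\<dots> \<le> (\<Sum>k\<le>n. exp (- u * s * n) * (?e u k + ?e (- u) k))"
    by (intro sum_mono2) auto
  also have "\<dots> = exp (- u * s * n) * (2 * (2 * exp (- v)) ^ n)"
    using sum_choose_exp[of n u] sum_choose_exp[of n "- u"] uv
    by (simp add: sum_distrib_left[symmetric] sum.distrib add.commute)
  also have "\<dots> = 2 * 2 ^ n * exp (- real n * (u * s + v))"
    by (simp add: power_mult_distrib exp_of_nat_mult[symmetric] mult_exp_exp algebra_simps)
  also have "u * s + v = rademacher_rate s"
    by (simp add: u_def v_def rademacher_rate_def field_simps)
  finally show ?thesis .
qed

section \<open>Lower bound by the largest binomial term\<close>

text \<open>Up to the factor \<open>n ^ n\<close> these are the probabilities of the binomial law
  with success probability m / n, whose mode is m: the ratio of the terms at k + 1 and k is (n - k)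
  m / ((k + 1) (n - m)), which passes 1 at k = m. Writing both terms times k + 1 with a common
  factor avoids the division.\<close>

lemma binomial_term_le_mode:
  fixes m n k :: nat
  assumes "m \<le> n" "k \<le> n"
  shows "(n choose k) * m ^ k * (n - m) ^ (n - k) \<le> (n choose m) * m ^ m * (n - m) ^ (n - m)"
proof -
  define T where "T k = (n choose k) * m ^ k * (n - m) ^ (n - k)" for k
  have T1: "Suc k * T (Suc k) = (n choose k) * m ^ k * (n - m) ^ (n - Suc k) * ((n - k) * m)" for k
  proof -
    have "Suc k * (n choose Suc k) = (n - k) * (n choose k)"
      by (metis binomial_absorb_comp binomial_absorption mult.commute)
    then have "Suc k * T (Suc k) = ((n - k) * (n choose k)) * m ^ Suc k * (n - m) ^ (n - Suc k)"
      by (simp add: T_def del: mult_Suc)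
    then show ?thesis by simp
  qed
  have T0: "Suc k * T k = (n choose k) * m ^ k * (n - m) ^ (n - Suc k) * (Suc k * (n - m))"
    if "k < n" for k
  proof -
    have "n - k = Suc (n - Suc k)" using that by simp
    then have "(n - m) ^ (n - k) = (n - m) ^ (n - Suc k) * (n - m)" by simp
    then show ?thesis by (simp add: T_def del: mult_Suc)
  qed
  have up: "T k \<le> T (Suc k)" if "k < m" for k
  proof -
    have "Suc k * (n - m) \<le> m * (n - k)" using that by (intro mult_le_mono) auto
    then have "Suc k * T k \<le> Suc k * T (Suc k)"
      unfolding T1 using T0[of k] that assms by (simp add: mult.commute del: mult_Suc)
    then show ?thesis by (simp only: Suc_mult_le_cancel1)
  qed
  have down: "T (Suc k) \<le> T k" if "m \<le> k" "k < n" for k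
  proof -
    have "m * (n - k) \<le> Suc k * (n - m)" using that by (intro mult_le_mono) auto
    then have "Suc k * T (Suc k) \<le> Suc k * T k"
      unfolding T1 using T0[of k] that by (simp add: mult.commute del: mult_Suc)
    then show ?thesis by (simp only: Suc_mult_le_cancel1)
  qed
  have "T k \<le> T m" if "k \<le> m" using that
  proof (induction rule: inc_induct)
    case (step j)
    then show ?case using up[of j] by simp
  qed simp
  moreover have "T k \<le> T m" if "m \<le> k" using that assms(2)
  proof (induction k rule: dec_induct)
    case (step j)
    then show ?case using down[of j] by simp
  qed simp
  ultimately have "T k \<le> T m" by linarith
  then show ?thesis by (simp add: T_def)
qed

text \<open>At s = 2 p - 1 the rate is ln 2 minus the entropy of p; here p = m / n. For m = 0 or m =
  n the conventions 0 * ln 0 = 0 and 0 ^ 0 = 1 match.\<close>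

lemma exp_rademacher_rate:
  fixes m n :: nat
  assumes "m \<le> n" "0 < n"
  shows "exp (real n * rademacher_rate ((2 * real m - real n) / real n))
           = 2 ^ n * real m ^ m * real (n - m) ^ (n - m) / real n ^ n"
proof -
  have pw: "exp (real k * ln (2 * real k / real n)) = (2 * real k / real n) ^ k" for k
    using assms(2) by (cases "k = 0") (auto simp: exp_of_nat_mult)
  have e1: "1 + (2 * real m - real n) / real n = 2 * real m / real n"
    and e2: "1 - (2 * real m - real n) / real n = 2 * real (n - m) / real n"
    using assms by (simp_all add: field_simps of_nat_diff)
  have "real n * rademacher_rate ((2 * real m - real n) / real n)
      = real m * ln (2 * real m / real n) + real (n - m) * ln (2 * real (n - m) / real n)"
    using assms(2) unfolding rademacher_rate_def e1 e2 by (simp add: distrib_left)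
  then have "exp (real n * rademacher_rate ((2 * real m - real n) / real n))
      = (2 * real m / real n) ^ m * (2 * real (n - m) / real n) ^ (n - m)"
    by (simp only: exp_add pw)
  also have "\<dots> = (2 ^ m * 2 ^ (n - m)) * real m ^ m * real (n - m) ^ (n - m) / (real n ^ m * real n ^ (n - m))"
    by (simp add: power_mult_distrib power_divide)
  also have "(2::real) ^ m * 2 ^ (n - m) = 2 ^ n"
    using assms by (simp flip: power_add)
  also have "real n ^ m * real n ^ (n - m) = real n ^ n"
    using assms by (simp flip: power_add)
  finally show ?thesis .
qed

text \<open>The expansion of \<open>(m + (n - m)) ^ n\<close> has n + 1 terms, and its largest one
  is at least their average. The factor n + 1 is invisible on the exponential scale.\<close>

lemma binomial_ge_exp_rate:
  fixes m n :: nat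
  assumes "m \<le> n" "0 < n"
  shows "exp (- real n * rademacher_rate ((2 * real m - real n) / real n)) / real (n + 1)
           \<le> real (n choose m) / 2 ^ n"
proof -
  have "n ^ n = (m + (n - m)) ^ n" using assms by simp
  also have "\<dots> = (\<Sum>k\<le>n. (n choose k) * m ^ k * (n - m) ^ (n - k))"
    by (subst binomial_ring) simp
  also have "\<dots> \<le> (\<Sum>k\<le>n. (n choose m) * m ^ m * (n - m) ^ (n - m))"
    using assms by (intro sum_mono binomial_term_le_mode) auto
  finally have "real (n ^ n) \<le> real ((n + 1) * ((n choose m) * m ^ m * (n - m) ^ (n - m)))"
    by (simp only: of_nat_le_iff) simp
  then have le: "real n ^ n \<le> real (n + 1) * real (n choose m) * (real m ^ m * real (n - m) ^ (n - m))"
    by (simp only: of_nat_mult of_nat_power mult.assoc)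
  define E where "E = exp (real n * rademacher_rate ((2 * real m - real n) / real n))"
  have E: "E > 0" by (simp add: E_def)
  have "E * real n ^ n = 2 ^ n * (real m ^ m * real (n - m) ^ (n - m))"
    using exp_rademacher_rate[OF assms] assms by (simp add: E_def)
  then have "real n ^ n * 2 ^ n \<le> real (n + 1) * real (n choose m) * (E * real n ^ n)"
    using mult_right_mono[OF le, of "2 ^ n"] by (simp add: mult_ac)
  then have "2 ^ n \<le> real (n + 1) * real (n choose m) * E"
    using assms by (simp add: mult_ac)
  then have "1 / E / real (n + 1) \<le> real (n choose m) / 2 ^ n"
    using E by (simp add: divide_simps mult_ac)
  moreover have "exp (- real n * rademacher_rate ((2 * real m - real n) / real n)) = 1 / E"
    by (simp add: E_def exp_minus divide_inverse)
  ultimately show ?thesis by simp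
qed

section \<open>Exponential moments of the rate\<close>

text \<open>Every k in the event is at least as far from n / 2 as the closest one. So Chernoff's
  bound at that closest k covers the whole event, and the rate there is large enough because that k
  belongs to the event.\<close>

lemma binomial_rate_tail_le:
  fixes y :: real
  assumes n: "0 < n"
  shows "(\<Sum>k | k \<le> n \<and> y \<le> real n * rademacher_rate (\<bar>2 * real k - real n\<bar> / real n). real (n choose k))
           \<le> 2 * 2 ^ n * exp (- y)" (is "sum _ ?A \<le> _")
proof (cases "?A = {}")
  case False
  let ?\<rho> = "\<lambda>k. \<bar>2 * real k - real n\<bar> / real n"
  have fin: "finite ?A" by simp
  have "Min (?\<rho> ` ?A) \<in> ?\<rho> ` ?A" using fin False by (intro Min_in finite_imageI) (simp_all only: image_is_empty not_False_eq_True)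
  then obtain k where k: "k \<in> ?A" "Min (?\<rho> ` ?A) = ?\<rho> k" by (rule imageE)
  have min: "?\<rho> k \<le> ?\<rho> j" if "j \<in> ?A" for j
    unfolding k(2)[symmetric] using that fin by (intro Min_le finite_imageI imageI)
  have "(\<Sum>k\<in>?A. real (n choose k))
      \<le> (\<Sum>j | j \<le> n \<and> ?\<rho> k * real n \<le> \<bar>2 * real j - real n\<bar>. real (n choose j))"
    using min n by (intro sum_mono2) (auto simp: field_simps)
  also have "\<dots> \<le> 2 * 2 ^ n * exp (- real n * rademacher_rate (?\<rho> k))"
    using k(1) n by (intro binomial_tail_le) (auto simp: divide_le_eq_1)
  also have "\<dots> \<le> 2 * 2 ^ n * exp (- y)"
    using k(1) by (intro mult_left_mono) auto
  finally show ?thesis .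
next
  case True
  show ?thesis unfolding True by simp
qed

text \<open>A layer-cake decomposition over unit steps of \<open>Y = n I \<bar>\<rho>\<bar>\<close>, whose tail decays faster than
  \<open>exp (- c Y)\<close>.\<close>

lemma binomial_exp_rate_moment_le:
  fixes c :: real
  assumes n: "0 < n" and c: "0 \<le> c" "c < 1"
  shows "(\<Sum>k\<le>n. real (n choose k) * exp (c * (real n * rademacher_rate (\<bar>2 * real k - real n\<bar> / real n))))
           \<le> 2 ^ n * (2 * exp c / (1 - exp (c - 1)))"
proof -
  define Y where "Y k = real n * rademacher_rate (\<bar>2 * real k - real n\<bar> / real n)" for k
  define J where "J k = nat \<lfloor>Y k\<rfloor>" for k
  define M where "M = Suc (Max (J ` {..n}))"
  have Y: "0 \<le> Y k" if "k \<le> n" for k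
    using that n by (auto simp: Y_def divide_le_eq_1 intro!: mult_nonneg_nonneg rademacher_rate_nonneg)
  have J: "real (J k) \<le> Y k" "Y k \<le> real (J k) + 1" if "k \<le> n" for k
    using Y[OF that] unfolding J_def by linarith+
  \<comment> \<open>The layer j = \<open>J k\<close> alone suffices, and \<open>M\<close> is large
    enough to include it for every k. Rounding Y up to j + 1 in the exponent costs the factor exp
    c.\<close>
  have step: "exp (c * Y k) \<le> (\<Sum>j<M. if real j \<le> Y k then exp (c * (real j + 1)) else 0)" if "k \<le> n" for k
  proof -
    have "exp (c * Y k) \<le> exp (c * (real (J k) + 1))"
      using J[OF that] c by (simp add: mult_left_mono)
    also have "\<dots> = (if real (J k) \<le> Y k then exp (c * (real (J k) + 1)) else 0)"
      using J[OF that] by simp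
    also have "\<dots> \<le> (\<Sum>j<M. if real j \<le> Y k then exp (c * (real j + 1)) else 0)"
    proof (rule member_le_sum)
      show "J k \<in> {..<M}" using that by (simp add: M_def less_Suc_eq_le)
    qed auto
    finally show ?thesis .
  qed
  have "(\<Sum>k\<le>n. real (n choose k) * exp (c * Y k))
      \<le> (\<Sum>k\<le>n. real (n choose k) * (\<Sum>j<M. if real j \<le> Y k then exp (c * (real j + 1)) else 0))"
    by (intro sum_mono mult_left_mono step) auto
  also have "\<dots> = (\<Sum>j<M. exp (c * (real j + 1)) * (\<Sum>k | k \<le> n \<and> real j \<le> Y k. real (n choose k)))"
  proof -
    have "(\<Sum>k\<le>n. real (n choose k) * (if real j \<le> Y k then e else 0))
        = e * (\<Sum>k | k \<le> n \<and> real j \<le> Y k. real (n choose k))" for j and e :: real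
    proof -
      have "{k. k \<le> n \<and> real j \<le> Y k} = {k \<in> {..n}. real j \<le> Y k}" by auto
      then have "(\<Sum>k | k \<le> n \<and> real j \<le> Y k. real (n choose k))
          = (\<Sum>k\<le>n. if real j \<le> Y k then real (n choose k) else 0)"
        by (simp only: sum.inter_filter finite_atMost)
      then show ?thesis
        by (simp add: sum_distrib_left if_distrib mult.commute cong: if_cong)
    qed
    then show ?thesis
      unfolding sum_distrib_left[of "real (n choose _)"] by (subst sum.swap) simp
  qed
  also have "\<dots> \<le> (\<Sum>j<M. exp (c * (real j + 1)) * (2 * 2 ^ n * exp (- real j)))"
    unfolding Y_def by (intro sum_mono mult_left_mono binomial_rate_tail_le n) auto
  \<comment> \<open>The tail exp (- j) against the weight exp (c j) leaves a geometric series,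
    convergent since c < 1.\<close>
  also have "\<dots> = (\<Sum>j<M. 2 ^ n * (2 * exp c) * exp (c - 1) ^ j)"
    by (intro sum.cong) (auto simp: exp_of_nat_mult[symmetric] mult_exp_exp algebra_simps)
  also have "\<dots> = 2 ^ n * (2 * exp c) * (\<Sum>j<M. exp (c - 1) ^ j)"
    by (rule sum_distrib_left[symmetric])
  also have "\<dots> \<le> 2 ^ n * (2 * exp c) * (1 / (1 - exp (c - 1)))"
  proof (intro mult_left_mono)
    show "(\<Sum>j<M. exp (c - 1) ^ j) \<le> 1 / (1 - exp (c - 1))"
      using c by (subst suminf_geometric[symmetric]) (auto intro!: sum_le_suminf summable_geometric)
  qed auto
  finally show ?thesis by (simp add: Y_def)
qed

section \<open>Gaussian integrals\<close>

lemma nn_integral_gaussian_shift: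
  fixes a b :: real
  assumes a: "0 < a"
  shows "(\<integral>\<^sup>+ t. ennreal (exp (- (1 / 2) * (a * t\<^sup>2 - 2 * b * t))) \<partial>lborel)
           = ennreal (sqrt (2 * pi / a) * exp (b\<^sup>2 / (2 * a)))"
proof -
  define \<sigma> where "\<sigma> = 1 / sqrt a"
  have \<sigma>: "\<sigma> > 0" "\<sigma>\<^sup>2 = 1 / a" using a by (auto simp: \<sigma>_def power_divide)
  have "exp (- (1 / 2) * (a * t\<^sup>2 - 2 * b * t))
      = sqrt (2 * pi / a) * exp (b\<^sup>2 / (2 * a)) * normal_density (b / a) \<sigma> t" for t
  proof -
    have "- (1 / 2) * (a * t\<^sup>2 - 2 * b * t) = b\<^sup>2 / (2 * a) + - (t - b / a)\<^sup>2 / (2 * \<sigma>\<^sup>2)"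
      using a unfolding \<sigma> by (simp add: field_simps power2_eq_square)
    then have "exp (- (1 / 2) * (a * t\<^sup>2 - 2 * b * t))
        = exp (b\<^sup>2 / (2 * a)) * exp (- (t - b / a)\<^sup>2 / (2 * \<sigma>\<^sup>2))"
      by (simp only: exp_add)
    then show ?thesis
      using a unfolding normal_density_def \<sigma>(2) by (simp add: real_sqrt_divide)
  qed
  then have "(\<integral>\<^sup>+ t. ennreal (exp (- (1 / 2) * (a * t\<^sup>2 - 2 * b * t))) \<partial>lborel)
      = (\<integral>\<^sup>+ t. ennreal (sqrt (2 * pi / a) * exp (b\<^sup>2 / (2 * a))) * ennreal (normal_density (b / a) \<sigma> t) \<partial>lborel)"
    using a by (simp add: ennreal_mult)
  also have "\<dots> = ennreal (sqrt (2 * pi / a) * exp (b\<^sup>2 / (2 * a))) * (\<integral>\<^sup>+ t. ennreal (normal_density (b / a) \<sigma> t) \<partial>lborel)"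
    by (rule nn_integral_cmult) simp
  also have "(\<integral>\<^sup>+ t. ennreal (normal_density (b / a) \<sigma> t) \<partial>lborel) = 1"
    using prob_space.emeasure_space_1[OF prob_space_normal_density[OF \<sigma>(1), of "b / a"]]
    by (simp add: emeasure_density)
  finally show ?thesis by simp
qed

section \<open>Gaussian integrals of rank two perturbations\<close>

lemma product_sigma_finite_lborel: "product_sigma_finite (\<lambda>_. lborel)"
  by unfold_locales

text \<open>The determinant below is that of \<open>1 - K C\<close>, where \<open>C = (p, q; q, r)\<close> and \<open>K\<close> is the Gram matrix
  of \<open>x\<close> and \<open>y\<close>.\<close>

definition gram_form_det :: "nat \<Rightarrow> (nat \<Rightarrow> real) \<Rightarrow> (nat \<Rightarrow> real) \<Rightarrow> real \<Rightarrow> real \<Rightarrow> real \<Rightarrow> real" where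
  "gram_form_det n x y p q r =
     (1 - (\<Sum>i<n. x i * x i) * p - (\<Sum>i<n. x i * y i) * q) *
     (1 - (\<Sum>i<n. x i * y i) * q - (\<Sum>i<n. y i * y i) * r) -
     ((\<Sum>i<n. x i * x i) * q + (\<Sum>i<n. x i * y i) * r) *
     ((\<Sum>i<n. x i * y i) * p + (\<Sum>i<n. y i * y i) * q)"

text \<open>The quadratic form of \<open>1 - U C U\<^sup>T\<close> with U = (x, y); by Sylvester's
  identity its determinant is \<open>gram_form_det\<close>. The applications have q = 0, but the
  off-diagonal coefficient appears once a coordinate is integrated out.\<close>

definition rank2_form :: "nat \<Rightarrow> (nat \<Rightarrow> real) \<Rightarrow> (nat \<Rightarrow> real) \<Rightarrow> real \<Rightarrow> real \<Rightarrow> real \<Rightarrow> (nat \<Rightarrow> real) \<Rightarrow> real" where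
  "rank2_form n x y p q r v =
     (\<Sum>i<n. (v i)\<^sup>2) - (p * (\<Sum>i<n. x i * v i)\<^sup>2 + 2 * q * (\<Sum>i<n. x i * v i) * (\<Sum>i<n. y i * v i)
       + r * (\<Sum>i<n. y i * v i)\<^sup>2)"

lemma rank2_form_measurable [measurable]:
  "rank2_form n x y p q r \<in> borel_measurable (PiM {..<n} (\<lambda>_. lborel))"
  unfolding rank2_form_def by measurable

text \<open>With \<open>z = (a, b) = (x n, y n)\<close> the coefficients of the last coordinate of the two linear forms and
  \<open>w = C z\<close>, completing the square in that coordinate replaces \<open>C\<close> by \<open>C + w w\<^sup>T / (1 - z\<^sup>T C z)\<close>.\<close>

lemma gram_form_det_step:
  fixes A B E a b p q r e w1 w2 :: real
  assumes e: "e * (1 - (p * a\<^sup>2 + 2 * q * a * b + r * b\<^sup>2)) = 1"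
    and w: "w1 = p * a + q * b" "w2 = q * a + r * b"
  shows "(1 - (A + a * a) * p - (B + a * b) * q) * (1 - (B + a * b) * q - (E + b * b) * r)
      - ((A + a * a) * q + (B + a * b) * r) * ((B + a * b) * p + (E + b * b) * q)
    = (1 - (p * a\<^sup>2 + 2 * q * a * b + r * b\<^sup>2)) *
      ((1 - A * (p + e * w1\<^sup>2) - B * (q + e * w1 * w2)) * (1 - B * (q + e * w1 * w2) - E * (r + e * w2\<^sup>2))
      - (A * (q + e * w1 * w2) + B * (r + e * w2\<^sup>2)) * (B * (p + e * w1\<^sup>2) + E * (q + e * w1 * w2)))"
proof -
  define S where "S = 1 - (p * a\<^sup>2 + 2 * q * a * b + r * b\<^sup>2)"
  define D where "D = (1 - A * p - B * q) * (1 - B * q - E * r) - (A * q + B * r) * (B * p + E * q)"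
  define X where "X = (A * E - B\<^sup>2) * (p * w2\<^sup>2 + r * w1\<^sup>2 - 2 * q * w1 * w2)
      - (A * w1\<^sup>2 + 2 * B * w1 * w2 + E * w2\<^sup>2)"
  have "(1 - A * (p + e * w1\<^sup>2) - B * (q + e * w1 * w2)) * (1 - B * (q + e * w1 * w2) - E * (r + e * w2\<^sup>2))
      - (A * (q + e * w1 * w2) + B * (r + e * w2\<^sup>2)) * (B * (p + e * w1\<^sup>2) + E * (q + e * w1 * w2))
    = D + e * X" (is "?D' = _")
    unfolding D_def X_def by (simp add: power2_eq_square algebra_simps)
  then have "S * ?D' = S * D + (e * S) * X" by (simp add: algebra_simps)
  also have "\<dots> = S * D + X" using e by (simp add: S_def)
  also have "\<dots> = (1 - (A + a * a) * p - (B + a * b) * q) * (1 - (B + a * b) * q - (E + b * b) * r)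
      - ((A + a * a) * q + (B + a * b) * r) * ((B + a * b) * p + (E + b * b) * q)"
    unfolding S_def D_def X_def w by (simp add: power2_eq_square algebra_simps)
  finally show ?thesis by (simp add: S_def)
qed

text \<open>Induction on the dimension, integrating out the last coordinate. The family of rank two
  forms is closed under this, with only C changing, which is why p, q, r are arbitrary in the
  induction. The determinant is the product of the pivots \<open>S\<close>, hence positive.\<close>

lemma gaussian_rank2_integral:
  assumes pd: "\<And>v. (\<exists>i<n. v i \<noteq> 0) \<Longrightarrow> 0 < rank2_form n x y p q r v"
  shows "0 < gram_form_det n x y p q r \<and>
    (\<integral>\<^sup>+ v. ennreal (exp (- (1 / 2) * rank2_form n x y p q r v)) \<partial>PiM {..<n} (\<lambda>_. lborel))
      = ennreal (sqrt ((2 * pi) ^ n / gram_form_det n x y p q r))"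
  using pd
proof (induction n arbitrary: p q r)
  case 0
  interpret product_sigma_finite "\<lambda>_. lborel :: real measure" by (rule product_sigma_finite_lborel)
  show ?case by (simp add: gram_form_det_def rank2_form_def nn_integral_empty space_PiM_empty)
next
  case (Suc n)
  interpret product_sigma_finite "\<lambda>_. lborel :: real measure" by (rule product_sigma_finite_lborel)
  define a b where "a = x n" and "b = y n"
  define w1 w2 where "w1 = p * a + q * b" and "w2 = q * a + r * b"
  define S where "S = 1 - (p * a\<^sup>2 + 2 * q * a * b + r * b\<^sup>2)"
  define p' q' r' where "p' = p + 1 / S * w1\<^sup>2" and "q' = q + 1 / S * w1 * w2" and "r' = r + 1 / S * w2\<^sup>2"
  define L where "L v = w1 * (\<Sum>i<n. x i * v i) + w2 * (\<Sum>i<n. y i * v i)" for v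
  have split: "rank2_form (Suc n) x y p q r (v(n := t)) =
      rank2_form n x y p q r v + (S * t\<^sup>2 - 2 * L v * t)" for v t
  proof -
    have s: "(\<Sum>i<n. (if i = n then t else v i)\<^sup>2) = (\<Sum>i<n. (v i)\<^sup>2)"
      "(\<Sum>i<n. z i * (if i = n then t else v i)) = (\<Sum>i<n. z i * v i)" for z :: "nat \<Rightarrow> real"
      by (auto intro!: sum.cong)
    show ?thesis
      unfolding rank2_form_def S_def L_def w1_def w2_def a_def b_def
      by (simp add: fun_upd_def s) (simp add: power2_eq_square algebra_simps)
  qed
  \<comment> \<open>The pivot is the value of the form at the last unit vector.\<close>
  have "rank2_form (Suc n) x y p q r ((\<lambda>_. 0)(n := 1)) = S"
    unfolding split by (simp add: rank2_form_def L_def)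
  moreover have "\<exists>i<Suc n. ((\<lambda>_. 0 :: real)(n := 1)) i \<noteq> 0" by (rule exI[of _ n]) simp
  ultimately have S: "S > 0" using Suc.prems by metis
  have complete: "rank2_form n x y p q r v - (L v)\<^sup>2 / S = rank2_form n x y p' q' r' v" for v
    unfolding rank2_form_def L_def p'_def q'_def r'_def
    by (simp add: power2_eq_square algebra_simps add_divide_distrib)
  have pd': "0 < rank2_form n x y p' q' r' v" if "\<exists>i<n. v i \<noteq> 0" for v
  proof -
    \<comment> \<open>The last coordinate \<open>L v / S\<close> minimises the form, and the minimum
      is the reduced form, which thus inherits positivity.\<close>
    have "\<exists>i<Suc n. (v(n := L v / S)) i \<noteq> 0" using that by (auto simp: less_Suc_eq)
    from Suc.prems[OF this] have "0 < rank2_form n x y p q r v + (S * (L v / S)\<^sup>2 - 2 * L v * (L v / S))"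
      unfolding split .
    also have "\<dots> = rank2_form n x y p q r v - (L v)\<^sup>2 / S"
      using S by (simp add: power2_eq_square field_simps)
    finally show ?thesis unfolding complete .
  qed
  have IH: "0 < gram_form_det n x y p' q' r'"
    "(\<integral>\<^sup>+ v. ennreal (exp (- (1 / 2) * rank2_form n x y p' q' r' v)) \<partial>PiM {..<n} (\<lambda>_. lborel))
      = ennreal (sqrt ((2 * pi) ^ n / gram_form_det n x y p' q' r'))"
    using Suc.IH[OF pd'] by blast+
  have "1 / S * (1 - (p * a\<^sup>2 + 2 * q * a * b + r * b\<^sup>2)) = 1" using S by (simp flip: S_def)
  from gram_form_det_step[OF this w1_def w2_def,
      of "\<Sum>i<n. x i * x i" "\<Sum>i<n. x i * y i" "\<Sum>i<n. y i * y i"]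
  have det: "gram_form_det (Suc n) x y p q r = S * gram_form_det n x y p' q' r'"
    unfolding gram_form_det_def p'_def q'_def r'_def by (simp flip: S_def a_def b_def)
  have "(\<integral>\<^sup>+ v. ennreal (exp (- (1 / 2) * rank2_form (Suc n) x y p q r v)) \<partial>PiM {..<Suc n} (\<lambda>_. lborel))
      = (\<integral>\<^sup>+ v. (\<integral>\<^sup>+ t. ennreal (exp (- (1 / 2) * rank2_form (Suc n) x y p q r (v(n := t)))) \<partial>lborel)
           \<partial>PiM {..<n} (\<lambda>_. lborel))"
    unfolding lessThan_Suc
    by (rule product_nn_integral_insert) (auto simp flip: lessThan_Suc)
  also have "\<dots> = (\<integral>\<^sup>+ v. ennreal (sqrt (2 * pi / S)) * ennreal (exp (- (1 / 2) * rank2_form n x y p' q' r' v))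
           \<partial>PiM {..<n} (\<lambda>_. lborel))"
  proof (intro nn_integral_cong)
    fix v
    have "(\<integral>\<^sup>+ t. ennreal (exp (- (1 / 2) * rank2_form (Suc n) x y p q r (v(n := t)))) \<partial>lborel)
        = (\<integral>\<^sup>+ t. ennreal (exp (- (1 / 2) * rank2_form n x y p q r v)) *
             ennreal (exp (- (1 / 2) * (S * t\<^sup>2 - 2 * L v * t))) \<partial>lborel)"
      unfolding split by (simp add: ennreal_mult[symmetric] mult_exp_exp algebra_simps)
    also have "\<dots> = ennreal (exp (- (1 / 2) * rank2_form n x y p q r v)) *
        ennreal (sqrt (2 * pi / S) * exp ((L v)\<^sup>2 / (2 * S)))"
      by (subst nn_integral_cmult, simp, simp only: nn_integral_gaussian_shift[OF S])
    also have "\<dots> = ennreal (sqrt (2 * pi / S)) * ennreal (exp (- (1 / 2) * rank2_form n x y p' q' r' v))"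
      unfolding complete[symmetric] using S
      by (simp add: ennreal_mult[symmetric] mult_exp_exp algebra_simps diff_divide_distrib)
    finally show "(\<integral>\<^sup>+ t. ennreal (exp (- (1 / 2) * rank2_form (Suc n) x y p q r (v(n := t)))) \<partial>lborel) = \<dots>" .
  qed
  also have "\<dots> = ennreal (sqrt (2 * pi / S)) * ennreal (sqrt ((2 * pi) ^ n / gram_form_det n x y p' q' r'))"
    by (subst nn_integral_cmult, simp, simp only: IH(2))
  also have "\<dots> = ennreal (sqrt ((2 * pi) ^ Suc n / gram_form_det (Suc n) x y p q r))"
    unfolding det using S IH(1) by (simp add: ennreal_mult[symmetric] real_sqrt_mult[symmetric])
  finally show ?case using S IH(1) by (simp add: det)
qed

section \<open>The spiked normal distribution\<close>

lemma spiked_covariance_carrier: "spiked_covariance n \<beta> x \<in> carrier_mat n n"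
  by (simp add: spiked_covariance_def)

lemma spiked_covariance_0: "spiked_covariance n 0 x = 1\<^sub>m n"
  by (auto simp: spiked_covariance_def intro!: eq_matI)

text \<open>\<open>x x\<^sup>T\<close> squares to a multiple of itself, so perturbations along a
  fixed x are closed under products.\<close>

lemma mult_spiked_covariance:
  "spiked_covariance n a x * spiked_covariance n b x
     = spiked_covariance n (a + b + a * b * (\<Sum>i<n. x i * x i)) x"
proof (rule eq_matI)
  fix i j assume "i < dim_row (spiked_covariance n (a + b + a * b * (\<Sum>i<n. x i * x i)) x)"
    and "j < dim_col (spiked_covariance n (a + b + a * b * (\<Sum>i<n. x i * x i)) x)"
  then have ij: "i < n" "j < n" by (auto simp: spiked_covariance_def)
  have "(spiked_covariance n a x * spiked_covariance n b x) $$ (i, j)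
      = (\<Sum>k<n. ((if k = i then 1 else 0) + a * (x i * x k)) * ((if k = j then 1 else 0) + b * (x k * x j)))"
    using ij by (simp add: spiked_covariance_def scalar_prod_def lessThan_atLeast0)
  also have "\<dots> = (\<Sum>k<n. (if k = i then (if i = j then 1 else 0) + b * (x i * x j) else 0) +
      (if k = j then a * (x i * x j) else 0) + a * b * (x i * x j) * (x k * x k))"
    by (intro sum.cong) (auto simp: algebra_simps)
  also have "\<dots> = (if i = j then 1 else 0) + (a + b + a * b * (\<Sum>i<n. x i * x i)) * (x i * x j)"
    unfolding sum.distrib sum_distrib_left[symmetric] using ij by (simp add: algebra_simps)
  also have "\<dots> = spiked_covariance n (a + b + a * b * (\<Sum>i<n. x i * x i)) x $$ (i, j)"
    using ij by (simp add: spiked_covariance_def)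
  finally show "(spiked_covariance n a x * spiked_covariance n b x) $$ (i, j) = \<dots>" .
qed (auto simp: spiked_covariance_def)

text \<open>The Sherman-Morrison formula: the coefficient is the one that makes the product's
  coefficient vanish. The two-sided inverse excludes \<open>None\<close>, and uniqueness of inverses
  identifies the returned matrix.\<close>

lemma mat_inverse_spiked_covariance:
  assumes "1 + \<beta> * (\<Sum>i<n. x i * x i) \<noteq> 0"
  shows "mat_inverse (spiked_covariance n \<beta> x)
    = Some (spiked_covariance n (- \<beta> / (1 + \<beta> * (\<Sum>i<n. x i * x i))) x)"
proof -
  let ?s = "\<Sum>i<n. x i * x i"
  let ?A = "spiked_covariance n \<beta> x" and ?B = "spiked_covariance n (- \<beta> / (1 + \<beta> * ?s)) x"
  have "\<beta> + - \<beta> / (1 + \<beta> * ?s) + \<beta> * (- \<beta> / (1 + \<beta> * ?s)) * ?s = 0"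
    using assms by (simp add: field_simps)
  then have AB: "?A * ?B = 1\<^sub>m n"
    unfolding mult_spiked_covariance by (simp add: spiked_covariance_0)
  have "- \<beta> / (1 + \<beta> * ?s) + \<beta> + - \<beta> / (1 + \<beta> * ?s) * \<beta> * ?s = 0"
    using assms by (simp add: field_simps)
  then have BA: "?B * ?A = 1\<^sub>m n"
    unfolding mult_spiked_covariance by (simp add: spiked_covariance_0)
  note car = spiked_covariance_carrier
  show ?thesis
  proof (cases "mat_inverse ?A")
    case None
    have "?A \<in> Units (ring_mat TYPE(real) n ())"
      using car AB BA by (auto simp: Units_def ring_mat_def)
    then show ?thesis using mat_inverse(1)[OF car None, where b = "()"] by blast
  next
    case (Some C)
    then have C: "C * ?A = 1\<^sub>m n" "C \<in> carrier_mat n n" using mat_inverse(2)[OF car] by auto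
    have "C = C * (?A * ?B)" using C AB by simp
    also have "\<dots> = C * ?A * ?B" using assoc_mult_mat[OF C(2) car car] by simp
    also have "\<dots> = ?B" by (simp only: C(1) left_mult_one_mat[OF car])
    finally show ?thesis using Some by simp
  qed
qed

text \<open>Both sides are the determinant of the block matrix with rows \<open>(1, - \<beta> x\<^sup>T)\<close> and \<open>(x, 1)\<close>.\<close>

lemma det_spiked_covariance:
  "Determinant.det (spiked_covariance n \<beta> x) = 1 + \<beta> * (\<Sum>i<n. x i * x i)"
proof -
  let ?s = "\<Sum>i<n. x i * x i"
  define u :: "real Matrix.mat" where "u = Matrix.mat n 1 (\<lambda>(i, j). x i)"
  define v :: "real Matrix.mat" where "v = Matrix.mat 1 n (\<lambda>(i, j). - \<beta> * x j)"
  define c :: "real Matrix.mat" where "c = Matrix.mat 1 1 (\<lambda>_. 1 + \<beta> * ?s)"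
  have car: "u \<in> carrier_mat n 1" "v \<in> carrier_mat 1 n" "c \<in> carrier_mat 1 1"
    by (auto simp: u_def v_def c_def)
  let ?I1 = "1\<^sub>m 1 :: real Matrix.mat" and ?In = "1\<^sub>m n :: real Matrix.mat"
  let ?S = "spiked_covariance n \<beta> x"
  have uv: "u * v + ?S = ?In"
    by (rule eq_matI) (auto simp: u_def v_def spiked_covariance_def scalar_prod_def)
  have vu: "c + v * u = ?I1"
    by (rule eq_matI) (auto simp: u_def v_def c_def scalar_prod_def sum_distrib_left lessThan_atLeast0 sum_negf mult.assoc)
  have "four_block_mat ?I1 (0\<^sub>m 1 n) u ?In * four_block_mat ?I1 v (0\<^sub>m n 1) ?S = four_block_mat ?I1 v u ?In"
    using car spiked_covariance_carrier[of n \<beta> x]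
    by (subst mult_four_block_mat[where ?n1.0 = 1 and ?n2.0 = n]) (auto simp: uv)
  moreover have "four_block_mat c v (0\<^sub>m n 1) ?In * four_block_mat ?I1 (0\<^sub>m 1 n) u ?In = four_block_mat ?I1 v u ?In"
    using car
    by (subst mult_four_block_mat[where ?n1.0 = 1 and ?n2.0 = n]) (auto simp: vu)
  ultimately have eq: "four_block_mat ?I1 (0\<^sub>m 1 n) u ?In * four_block_mat ?I1 v (0\<^sub>m n 1) ?S
      = four_block_mat c v (0\<^sub>m n 1) ?In * four_block_mat ?I1 (0\<^sub>m 1 n) u ?In" by simp
  have "Determinant.det (four_block_mat ?I1 (0\<^sub>m 1 n) u ?In) * Determinant.det (four_block_mat ?I1 v (0\<^sub>m n 1) ?S)
      = Determinant.det (four_block_mat c v (0\<^sub>m n 1) ?In) * Determinant.det (four_block_mat ?I1 (0\<^sub>m 1 n) u ?In)"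
    using arg_cong[OF eq, of Determinant.det] car spiked_covariance_carrier[of n \<beta> x]
    by (subst (asm) (1 2) det_mult[of _ "1 + n"]) auto
  then have "Determinant.det ?S = Determinant.det c"
    using car spiked_covariance_carrier[of n \<beta> x]
    by (simp add: det_four_block_mat_upper_right_zero[of _ 1 _ n] det_four_block_mat_lower_left_zero[of _ 1 _ n])
  also have "\<dots> = 1 + \<beta> * ?s" using car by (simp add: det_single) (simp add: c_def)
  finally show ?thesis .
qed

lemma scalar_prod_spiked_covariance:
  "Matrix.scalar_prod (Matrix.vec n v) (spiked_covariance n a x *\<^sub>v Matrix.vec n v)
     = (\<Sum>i<n. (v i)\<^sup>2) + a * (\<Sum>i<n. x i * v i)\<^sup>2"
proof -
  have "Matrix.scalar_prod (Matrix.vec n v) (spiked_covariance n a x *\<^sub>v Matrix.vec n v)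
      = (\<Sum>i<n. v i * (\<Sum>j<n. ((if j = i then 1 else 0) + a * (x i * x j)) * v j))"
    by (simp add: scalar_prod_def lessThan_atLeast0 spiked_covariance_def)
  also have "\<dots> = (\<Sum>i<n. v i * (v i + a * x i * (\<Sum>j<n. x j * v j)))"
  proof (intro sum.cong refl)
    fix i assume "i \<in> {..<n}"
    then have "(\<Sum>j<n. (if j = i then 1 else 0) * v j) = v i"
      by (subst if_distrib[of "\<lambda>u. u * _"]) (simp cong: if_cong)
    then have "(\<Sum>j<n. ((if j = i then 1 else 0) + a * (x i * x j)) * v j) = v i + a * x i * (\<Sum>j<n. x j * v j)"
      by (simp add: distrib_right sum.distrib sum_distrib_left mult.assoc)
    then show "v i * (\<Sum>j<n. ((if j = i then 1 else 0) + a * (x i * x j)) * v j)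
        = v i * (v i + a * x i * (\<Sum>j<n. x j * v j))" by simp
  qed
  also have "\<dots> = (\<Sum>i<n. (v i)\<^sup>2) + a * (\<Sum>i<n. x i * v i) * (\<Sum>j<n. x j * v j)"
    by (simp add: distrib_left sum.distrib power2_eq_square sum_distrib_left sum_distrib_right mult_ac)
  finally show ?thesis by (simp add: power2_eq_square)
qed

lemma mv_normal_spiked_covariance:
  assumes "1 + \<beta> * (\<Sum>i<n. x i * x i) > 0"
  shows "mv_normal n (spiked_covariance n \<beta> x) = density (PiM {..<n} (\<lambda>_. lborel))
    (\<lambda>v. ennreal (exp (- (1 / 2) * rank2_form n x y (\<beta> / (1 + \<beta> * (\<Sum>i<n. x i * x i))) 0 0 v) /
       sqrt ((2 * pi) ^ n * (1 + \<beta> * (\<Sum>i<n. x i * x i)))))"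
  using assms unfolding mv_normal_def
  by (simp add: mat_inverse_spiked_covariance det_spiked_covariance scalar_prod_spiked_covariance rank2_form_def)

text \<open>The likelihood ratio of a single column, spiked against standard; the exponent comes
  from Sherman-Morrison, the denominator from the determinant.\<close>

definition spike_ratio :: "nat \<Rightarrow> real \<Rightarrow> (nat \<Rightarrow> real) \<Rightarrow> (nat \<Rightarrow> real) \<Rightarrow> real" where
  "spike_ratio n \<beta> x v =
     exp (\<beta> / (1 + \<beta> * (\<Sum>i<n. x i * x i)) * (\<Sum>i<n. x i * v i)\<^sup>2 / 2) / sqrt (1 + \<beta> * (\<Sum>i<n. x i * x i))"

lemma spike_ratio_nonneg: "0 \<le> 1 + \<beta> * (\<Sum>i<n. x i * x i) \<Longrightarrow> 0 \<le> spike_ratio n \<beta> x v"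
  by (simp add: spike_ratio_def)

lemma sets_mv_normal [simp, measurable_cong]:
  "sets (mv_normal n \<Sigma>) = sets (PiM {..<n} (\<lambda>_. borel))"
  by (simp add: mv_normal_def cong: sets_PiM_cong)

lemma spike_ratio_measurable [measurable]:
  "spike_ratio n \<beta> x \<in> borel_measurable (PiM {..<n} (\<lambda>_. borel))"
  unfolding spike_ratio_def by measurable

lemma mv_normal_standard:
  "mv_normal n (1\<^sub>m n) = density (PiM {..<n} (\<lambda>_. lborel))
    (\<lambda>v. ennreal (exp (- (1 / 2) * (\<Sum>i<n. (v i)\<^sup>2)) / sqrt ((2 * pi) ^ n)))"
  using mv_normal_spiked_covariance[of 0 "\<lambda>_. 0" n] by (simp add: spiked_covariance_0 rank2_form_def)

lemma mv_normal_eq_density_spike_ratio: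
  assumes "1 + \<beta> * (\<Sum>i<n. x i * x i) > 0"
  shows "mv_normal n (spiked_covariance n \<beta> x) = density (mv_normal n (1\<^sub>m n)) (\<lambda>v. ennreal (spike_ratio n \<beta> x v))"
proof -
  have "exp (- (1 / 2) * rank2_form n x x (\<beta> / (1 + \<beta> * (\<Sum>i<n. x i * x i))) 0 0 v)
      = exp (- (1 / 2) * (\<Sum>i<n. (v i)\<^sup>2)) *
        exp (\<beta> / (1 + \<beta> * (\<Sum>i<n. x i * x i)) * (\<Sum>i<n. x i * v i)\<^sup>2 / 2)" for v
    unfolding rank2_form_def mult_exp_exp by (rule arg_cong[of _ _ exp]) (simp add: diff_divide_distrib)
  then have "exp (- (1 / 2) * rank2_form n x x (\<beta> / (1 + \<beta> * (\<Sum>i<n. x i * x i))) 0 0 v) /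
       sqrt ((2 * pi) ^ n * (1 + \<beta> * (\<Sum>i<n. x i * x i)))
     = exp (- (1 / 2) * (\<Sum>i<n. (v i)\<^sup>2)) / sqrt ((2 * pi) ^ n) * spike_ratio n \<beta> x v" for v
    unfolding spike_ratio_def real_sqrt_mult by simp
  then have "ennreal (exp (- (1 / 2) * rank2_form n x x (\<beta> / (1 + \<beta> * (\<Sum>i<n. x i * x i))) 0 0 v) /
       sqrt ((2 * pi) ^ n * (1 + \<beta> * (\<Sum>i<n. x i * x i))))
     = ennreal (exp (- (1 / 2) * (\<Sum>i<n. (v i)\<^sup>2)) / sqrt ((2 * pi) ^ n)) * ennreal (spike_ratio n \<beta> x v)" for v
    using assms by (simp only:) (rule ennreal_mult; simp add: spike_ratio_nonneg)
  then show ?thesis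
    unfolding mv_normal_standard mv_normal_spiked_covariance[OF assms, where y = x]
    by (subst density_density_eq) auto
qed

section \<open>Integrals of one and of two likelihood ratios\<close>

text \<open>Cauchy-Schwarz. The factor 2 prepares the form with two spikes, where each of them may
  use up half of the squared norm of v.\<close>

lemma scaled_inner_square_less:
  fixes x v :: "nat \<Rightarrow> real"
  assumes a: "2 * a * (\<Sum>i<n. x i * x i) < 1" and v: "\<exists>i<n. v i \<noteq> 0"
  shows "2 * a * (\<Sum>i<n. x i * v i)\<^sup>2 < (\<Sum>i<n. (v i)\<^sup>2)"
proof -
  have v: "0 < (\<Sum>i<n. (v i)\<^sup>2)"
    using v by (auto intro!: sum_pos2)
  show ?thesis
  proof (cases "a \<le> 0")
    case True
    then have "2 * a * (\<Sum>i<n. x i * v i)\<^sup>2 \<le> 0" by (simp add: mult_nonpos_nonneg)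
    then show ?thesis using v by simp
  next
    case False
    have "(\<Sum>i<n. x i * v i)\<^sup>2 \<le> (\<Sum>i<n. (x i)\<^sup>2) * (\<Sum>i<n. (v i)\<^sup>2)"
      by (rule Cauchy_Schwarz_ineq_sum)
    then have "2 * a * (\<Sum>i<n. x i * v i)\<^sup>2 \<le> 2 * a * ((\<Sum>i<n. (x i)\<^sup>2) * (\<Sum>i<n. (v i)\<^sup>2))"
      using False by (intro mult_left_mono) auto
    also have "\<dots> < 1 * (\<Sum>i<n. (v i)\<^sup>2)"
      using mult_strict_right_mono[OF a v] by (simp add: power2_eq_square mult.assoc)
    finally show ?thesis by simp
  qed
qed

lemma prob_space_mv_normal_spiked:
  assumes s: "\<bar>\<beta> * (\<Sum>i<n. x i * x i)\<bar> < 1"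
  shows "prob_space (mv_normal n (spiked_covariance n \<beta> x))"
proof
  let ?s = "\<Sum>i<n. x i * x i"
  define a where "a = \<beta> / (1 + \<beta> * ?s)"
  have pos: "1 + \<beta> * ?s > 0" using s by simp
  \<comment> \<open>After clearing the denominator this says that \<open>\<beta> * ?s\<close> is
    below 1.\<close>
  have as: "2 * a * ?s < 1" using s pos by (simp add: a_def divide_less_eq)
  have pd: "0 < rank2_form n x x a 0 0 v" if v: "\<exists>i<n. v i \<noteq> 0" for v
  proof -
    have "2 * a * (\<Sum>i<n. x i * v i)\<^sup>2 < (\<Sum>i<n. (v i)\<^sup>2)" by (rule scaled_inner_square_less[OF as v])
    moreover have "0 \<le> (\<Sum>i<n. (v i)\<^sup>2)" by (intro sum_nonneg) simp
    ultimately show ?thesis by (simp add: rank2_form_def)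
  qed
  have det: "gram_form_det n x x a 0 0 = 1 / (1 + \<beta> * ?s)"
    using pos by (simp add: gram_form_det_def a_def field_simps)
  have "emeasure (mv_normal n (spiked_covariance n \<beta> x)) (space (mv_normal n (spiked_covariance n \<beta> x)))
    = (\<integral>\<^sup>+ v. ennreal (exp (- (1 / 2) * rank2_form n x x a 0 0 v) / sqrt ((2 * pi) ^ n * (1 + \<beta> * ?s)))
        \<partial>PiM {..<n} (\<lambda>_. lborel))"
    unfolding mv_normal_spiked_covariance[OF pos, of x] a_def[symmetric]
    by (simp add: emeasure_density cong: nn_integral_cong)
  also have "\<dots> = (\<integral>\<^sup>+ v. ennreal (1 / sqrt ((2 * pi) ^ n * (1 + \<beta> * ?s))) * ennreal (exp (- (1 / 2) * rank2_form n x x a 0 0 v))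
        \<partial>PiM {..<n} (\<lambda>_. lborel))"
    using pos by (simp add: ennreal_mult[symmetric])
  also have "\<dots> = ennreal (1 / sqrt ((2 * pi) ^ n * (1 + \<beta> * ?s))) * ennreal (sqrt ((2 * pi) ^ n / (1 / (1 + \<beta> * ?s))))"
    using gaussian_rank2_integral[OF pd] det by (subst nn_integral_cmult) auto
  also have "\<dots> = 1"
    using pos by (subst ennreal_mult[symmetric]) auto
  finally show "emeasure (mv_normal n (spiked_covariance n \<beta> x)) (space (mv_normal n (spiked_covariance n \<beta> x))) = 1" .
qed

text \<open>Both ratios and the standard density combine to a rank two Gaussian with C = a 1. Its
  determinant is (1 - a)^2 - a^2 \<rho>^2 with 1 - a = 1 / (1 + \<beta>), and the powers of 1 +
  \<beta> cancel against the normalisations. Positivity of this determinant is the first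
  claim.\<close>

lemma nn_integral_spike_ratio_mult:
  assumes x: "(\<Sum>i<n. x i * x i) = 1" and y: "(\<Sum>i<n. y i * y i) = 1" and \<beta>: "\<bar>\<beta>\<bar> < 1"
  shows "\<beta>\<^sup>2 * (\<Sum>i<n. x i * y i)\<^sup>2 < 1"
    and "(\<integral>\<^sup>+ v. ennreal (spike_ratio n \<beta> x v * spike_ratio n \<beta> y v) \<partial>mv_normal n (1\<^sub>m n))
           = ennreal (1 / sqrt (1 - \<beta>\<^sup>2 * (\<Sum>i<n. x i * y i)\<^sup>2))"
proof -
  let ?\<rho> = "\<Sum>i<n. x i * y i"
  define a where "a = \<beta> / (1 + \<beta>)"
  have pos: "1 + \<beta> > 0" using \<beta> by simp
  have as: "2 * a < 1" using \<beta> pos by (simp add: a_def divide_less_eq)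
  have pd: "0 < rank2_form n x y a 0 a v" if v: "\<exists>i<n. v i \<noteq> 0" for v
    using scaled_inner_square_less[OF _ v, of a x] scaled_inner_square_less[OF _ v, of a y] as x y
    by (simp add: rank2_form_def)
  have det: "gram_form_det n x y a 0 a = (1 - \<beta>\<^sup>2 * ?\<rho>\<^sup>2) / (1 + \<beta>)\<^sup>2"
  proof -
    have "1 - a = 1 / (1 + \<beta>)" using pos by (simp add: a_def field_simps)
    then show ?thesis
      by (simp add: gram_form_det_def x y) (simp add: a_def diff_divide_distrib power2_eq_square)
  qed
  note G = gaussian_rank2_integral[OF pd, unfolded det]
  then have "0 < (1 - \<beta>\<^sup>2 * ?\<rho>\<^sup>2) / (1 + \<beta>)\<^sup>2" by blast
  then show lt: "\<beta>\<^sup>2 * ?\<rho>\<^sup>2 < 1" using pos by (simp add: zero_less_divide_iff)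
  have eq: "exp (- (1 / 2) * (\<Sum>i<n. (v i)\<^sup>2)) / sqrt ((2 * pi) ^ n) * (spike_ratio n \<beta> x v * spike_ratio n \<beta> y v)
    = 1 / (sqrt ((2 * pi) ^ n) * (1 + \<beta>)) * exp (- (1 / 2) * rank2_form n x y a 0 a v)" for v
    using pos unfolding spike_ratio_def rank2_form_def x y
    by (simp add: mult_exp_exp a_def algebra_simps diff_divide_distrib)
  have nonneg: "0 \<le> spike_ratio n \<beta> x v * spike_ratio n \<beta> y v" for v
    using pos x y by (intro mult_nonneg_nonneg spike_ratio_nonneg) auto
  have "(\<integral>\<^sup>+ v. ennreal (spike_ratio n \<beta> x v * spike_ratio n \<beta> y v) \<partial>mv_normal n (1\<^sub>m n))
    = (\<integral>\<^sup>+ v. ennreal (exp (- (1 / 2) * (\<Sum>i<n. (v i)\<^sup>2)) / sqrt ((2 * pi) ^ n) * (spike_ratio n \<beta> x v * spike_ratio n \<beta> y v))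
       \<partial>PiM {..<n} (\<lambda>_. lborel))"
    unfolding mv_normal_standard
    by (subst nn_integral_density) (auto simp: ennreal_mult[symmetric] nonneg)
  also have "\<dots> = ennreal (1 / (sqrt ((2 * pi) ^ n) * (1 + \<beta>))) * ennreal (sqrt ((2 * pi) ^ n / ((1 - \<beta>\<^sup>2 * ?\<rho>\<^sup>2) / (1 + \<beta>)\<^sup>2)))"
    unfolding eq using pos G by (subst ennreal_mult, simp, simp, subst nn_integral_cmult) auto
  also have "\<dots> = ennreal (1 / sqrt (1 - \<beta>\<^sup>2 * ?\<rho>\<^sup>2))"
    using pos lt by (subst ennreal_mult[symmetric]) (auto simp: real_sqrt_divide real_sqrt_mult)
  finally show "(\<integral>\<^sup>+ v. ennreal (spike_ratio n \<beta> x v * spike_ratio n \<beta> y v) \<partial>mv_normal n (1\<^sub>m n))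
    = ennreal (1 / sqrt (1 - \<beta>\<^sup>2 * ?\<rho>\<^sup>2))" .
qed

section \<open>Likelihood ratios of the whole sample\<close>

text \<open>On boxes the integral of the product density factorises, and boxes determine a product
  of sigma-finite measures.\<close>

lemma density_PiM:
  fixes f :: "'a \<Rightarrow> ennreal"
  assumes I: "finite I" and M: "sigma_finite_measure M" and D: "sigma_finite_measure (density M f)"
    and f [measurable]: "f \<in> borel_measurable M"
  shows "density (PiM I (\<lambda>_. M)) (\<lambda>X. \<Prod>i\<in>I. f (X i)) = PiM I (\<lambda>_. density M f)"
proof -
  interpret M: product_sigma_finite "\<lambda>_. M" using M by (simp add: product_sigma_finite_def)
  interpret D: product_sigma_finite "\<lambda>_. density M f" using D by (simp add: product_sigma_finite_def)
  note I [simp]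
  have sets: "sets (PiM I (\<lambda>_. density M f)) = sets (PiM I (\<lambda>_. M))"
    by (intro sets_PiM_cong) auto
  show ?thesis
  proof (rule D.PiM_eqI)
    fix A assume "\<And>i. i \<in> I \<Longrightarrow> A i \<in> sets (density M f)"
    then have A: "\<And>i. i \<in> I \<Longrightarrow> A i \<in> sets M" by simp
    then have [measurable]: "PiE I A \<in> sets (PiM I (\<lambda>_. M))" by (intro sets_PiM_I_finite) auto
    have "emeasure (density (PiM I (\<lambda>_. M)) (\<lambda>X. \<Prod>i\<in>I. f (X i))) (PiE I A)
        = (\<integral>\<^sup>+ X. (\<Prod>i\<in>I. f (X i)) * indicator (PiE I A) X \<partial>PiM I (\<lambda>_. M))"
      by (rule emeasure_density) measurable
    also have "\<dots> = (\<integral>\<^sup>+ X. (\<Prod>i\<in>I. f (X i) * indicator (A i) (X i)) \<partial>PiM I (\<lambda>_. M))"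
    proof (intro nn_integral_cong)
      fix X assume "X \<in> space (PiM I (\<lambda>_. M))"
      then have "indicator (PiE I A) X = (\<Prod>i\<in>I. indicator (A i) (X i) :: ennreal)"
        by (auto simp: space_PiM PiE_iff indicator_def)
      then show "(\<Prod>i\<in>I. f (X i)) * indicator (PiE I A) X = (\<Prod>i\<in>I. f (X i) * indicator (A i) (X i))"
        by (simp add: prod.distrib)
    qed
    also have "\<dots> = (\<Prod>i\<in>I. \<integral>\<^sup>+ v. f v * indicator (A i) v \<partial>M)"
      using A by (intro M.product_nn_integral_prod) auto
    also have "\<dots> = (\<Prod>i\<in>I. emeasure (density M f) (A i))"
      using A by (intro prod.cong refl emeasure_density[symmetric]) auto
    finally show "emeasure (density (PiM I (\<lambda>_. M)) (\<lambda>X. \<Prod>i\<in>I. f (X i))) (PiE I A)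
      = (\<Prod>i\<in>I. emeasure (density M f) (A i))" .
  qed (simp_all add: sets)
qed

text \<open>The map inside \<open>gram_law\<close>, named so that events of the Gram matrix can be
  pulled back to the sample.\<close>

definition gram_map :: "nat \<Rightarrow> nat \<Rightarrow> (nat \<Rightarrow> nat \<Rightarrow> real) \<Rightarrow> nat \<times> nat \<Rightarrow> real" where
  "gram_map n N X = (\<lambda>(i, j) \<in> {..<n} \<times> {..<n}. \<Sum>k<N. X k i * X k j)"

lemma gram_map_measurable:
  "gram_map n N \<in> measurable (PiM {..<N} (\<lambda>_. mv_normal n \<Sigma>)) (PiM ({..<n} \<times> {..<n}) (\<lambda>_. borel))"
  unfolding gram_map_def
proof (intro measurable_restrict)
  fix ij assume "ij \<in> {..<n} \<times> {..<n}"
  then obtain i j where [simp]: "ij = (i, j)" and ij: "i < n" "j < n" by auto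
  have [measurable]: "(\<lambda>X. X k l) \<in> borel_measurable (PiM {..<N} (\<lambda>_. mv_normal n \<Sigma>))" if "k < N" "l < n" for k l
  proof -
    have "(\<lambda>X. X k) \<in> measurable (PiM {..<N} (\<lambda>_. mv_normal n \<Sigma>)) (mv_normal n \<Sigma>)"
      using that by (intro measurable_component_singleton) auto
    moreover have "(\<lambda>v. v l) \<in> borel_measurable (mv_normal n \<Sigma>)"
      using that by (subst measurable_cong_sets[OF sets_mv_normal refl]) (rule measurable_component_singleton, simp)
    ultimately show ?thesis by (rule measurable_compose)
  qed
  show "(\<lambda>X. case ij of (i, j) \<Rightarrow> \<Sum>k<N. X k i * X k j) \<in> borel_measurable (PiM {..<N} (\<lambda>_. mv_normal n \<Sigma>))"
    using ij by simp
qed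

lemma gram_law_eq_distr:
  "gram_law n N \<Sigma> = distr (PiM {..<N} (\<lambda>_. mv_normal n \<Sigma>)) (PiM ({..<n} \<times> {..<n}) (\<lambda>_. borel)) (gram_map n N)"
  by (simp add: gram_law_def gram_map_def[abs_def])

lemma sets_gram_law [simp]: "sets (gram_law n N \<Sigma>) = sets (PiM ({..<n} \<times> {..<n}) (\<lambda>_. borel))"
  by (simp add: gram_law_def)

lemma prob_space_gram_law:
  assumes "prob_space (mv_normal n \<Sigma>)"
  shows "prob_space (gram_law n N \<Sigma>)"
  unfolding gram_law_eq_distr
  by (intro prob_space.prob_space_distr prob_space_PiM assms gram_map_measurable)

lemma prob_space_mv_normal_standard: "prob_space (mv_normal n (1\<^sub>m n))"
  using prob_space_mv_normal_spiked[of 0 "\<lambda>_. 0" n] by (simp add: spiked_covariance_0)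

lemma emeasure_gram_law_spiked:
  assumes s: "\<bar>\<beta> * (\<Sum>i<n. x i * x i)\<bar> < 1"
    and A: "A \<in> sets (PiM ({..<n} \<times> {..<n}) (\<lambda>_. borel))"
  shows "emeasure (gram_law n N (spiked_covariance n \<beta> x)) A
    = (\<integral>\<^sup>+ X. ennreal (\<Prod>k<N. spike_ratio n \<beta> x (X k)) * indicator A (gram_map n N X)
        \<partial>PiM {..<N} (\<lambda>_. mv_normal n (1\<^sub>m n)))"
proof -
  let ?Q = "mv_normal n (1\<^sub>m n)" and ?P = "mv_normal n (spiked_covariance n \<beta> x)"
  have pos: "1 + \<beta> * (\<Sum>i<n. x i * x i) > 0" using s by simp
  note P = mv_normal_eq_density_spike_ratio[OF pos]
  interpret Q: prob_space ?Q by (rule prob_space_mv_normal_standard)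
  interpret P: prob_space ?P by (rule prob_space_mv_normal_spiked[OF s])
  have meas: "(\<lambda>v. ennreal (spike_ratio n \<beta> x v)) \<in> borel_measurable ?Q" by measurable
  have sf: "sigma_finite_measure (density ?Q (\<lambda>v. ennreal (spike_ratio n \<beta> x v)))"
    using P.sigma_finite_measure_axioms unfolding P .
  have dens: "PiM {..<N} (\<lambda>_. ?P) = density (PiM {..<N} (\<lambda>_. ?Q)) (\<lambda>X. \<Prod>k<N. ennreal (spike_ratio n \<beta> x (X k)))"
    unfolding P by (rule density_PiM[OF _ Q.sigma_finite_measure_axioms sf meas, symmetric]) simp
  have [measurable]: "(\<lambda>X. \<Prod>k<N. ennreal (spike_ratio n \<beta> x (X k))) \<in> borel_measurable (PiM {..<N} (\<lambda>_. ?Q))"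
    by (intro borel_measurable_prod_ennreal measurable_compose[OF measurable_component_singleton[of _ _ "\<lambda>_. ?Q"] meas]) auto
  note A [measurable] gram_map_measurable [measurable]
  have "emeasure (gram_law n N (spiked_covariance n \<beta> x)) A
      = (\<integral>\<^sup>+ X. indicator A (gram_map n N X) \<partial>PiM {..<N} (\<lambda>_. ?P))"
    unfolding gram_law_eq_distr
    by (subst nn_integral_indicator[symmetric], simp add: A, subst nn_integral_distr) (auto intro: gram_map_measurable A)
  also have "\<dots> = (\<integral>\<^sup>+ X. (\<Prod>k<N. ennreal (spike_ratio n \<beta> x (X k))) * indicator A (gram_map n N X) \<partial>PiM {..<N} (\<lambda>_. ?Q))"
    unfolding dens by (rule nn_integral_density) (measurable)
  finally show ?thesis
    using pos by (simp add: prod_ennreal spike_ratio_nonneg)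
qed

text \<open>Under the unspiked law the columns are independent and the ratios factor over
  them.\<close>

lemma nn_integral_prod_spike_ratio_mult:
  assumes x: "(\<Sum>i<n. x i * x i) = 1" and y: "(\<Sum>i<n. y i * y i) = 1" and \<beta>: "\<bar>\<beta>\<bar> < 1"
  shows "(\<integral>\<^sup>+ X. ennreal ((\<Prod>k<N. spike_ratio n \<beta> x (X k)) * (\<Prod>k<N. spike_ratio n \<beta> y (X k)))
            \<partial>PiM {..<N} (\<lambda>_. mv_normal n (1\<^sub>m n)))
       = ennreal ((1 / sqrt (1 - \<beta>\<^sup>2 * (\<Sum>i<n. x i * y i)\<^sup>2)) ^ N)"
proof -
  let ?Q = "mv_normal n (1\<^sub>m n)"
  interpret Q: prob_space ?Q by (rule prob_space_mv_normal_standard)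
  interpret PQ: product_sigma_finite "\<lambda>_ :: nat. ?Q"
    by (simp add: product_sigma_finite_def Q.sigma_finite_measure_axioms)
  have nonneg: "0 \<le> spike_ratio n \<beta> x v * spike_ratio n \<beta> y v" for v
    using \<beta> x y by (intro mult_nonneg_nonneg spike_ratio_nonneg) auto
  have lt: "\<beta>\<^sup>2 * (\<Sum>i<n. x i * y i)\<^sup>2 < 1" by (rule nn_integral_spike_ratio_mult(1)[OF assms])
  have "(\<integral>\<^sup>+ X. ennreal ((\<Prod>k<N. spike_ratio n \<beta> x (X k)) * (\<Prod>k<N. spike_ratio n \<beta> y (X k))) \<partial>PiM {..<N} (\<lambda>_. ?Q))
      = (\<integral>\<^sup>+ X. (\<Prod>k<N. ennreal (spike_ratio n \<beta> x (X k) * spike_ratio n \<beta> y (X k))) \<partial>PiM {..<N} (\<lambda>_. ?Q))"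
    by (simp add: prod_ennreal nonneg prod.distrib)
  also have "\<dots> = (\<Prod>k<N. \<integral>\<^sup>+ v. ennreal (spike_ratio n \<beta> x v * spike_ratio n \<beta> y v) \<partial>?Q)"
    by (rule PQ.product_nn_integral_prod) auto
  also have "\<dots> = ennreal ((1 / sqrt (1 - \<beta>\<^sup>2 * (\<Sum>i<n. x i * y i)\<^sup>2)) ^ N)"
    unfolding nn_integral_spike_ratio_mult(2)[OF assms] using lt by (simp add: ennreal_power)
  finally show ?thesis .
qed

section \<open>The Rademacher prior\<close>

definition sign_vectors :: "nat \<Rightarrow> (nat \<Rightarrow> real) set" where
  "sign_vectors n = PiE {..<n} (\<lambda>_. {1 / sqrt (real n), - (1 / sqrt (real n))})"

lemma finite_sign_vectors [simp]: "finite (sign_vectors n)"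
  by (simp add: sign_vectors_def finite_PiE)

lemma sign_vectors_nonempty [simp]: "sign_vectors n \<noteq> {}"
  by (simp add: sign_vectors_def PiE_eq_empty_iff)

text \<open>For n = 0 the two values coincide, as 1 / sqrt 0 = 0, but the empty product still has
  one element.\<close>

lemma card_sign_vectors: "card (sign_vectors n) = 2 ^ n"
proof (cases "n = 0")
  case False
  then have "1 / sqrt (real n) \<noteq> - (1 / sqrt (real n))" by (simp add: field_simps)
  then show ?thesis by (simp add: sign_vectors_def card_PiE numeral_2_eq_2)
qed (simp add: sign_vectors_def)

lemma sign_vectors_square:
  assumes "x \<in> sign_vectors n" "i < n"
  shows "x i * x i = 1 / real n"
  using PiE_mem[OF assms(1)[unfolded sign_vectors_def], of i] assms(2) by auto

lemma sign_vectors_norm: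
  assumes "x \<in> sign_vectors n" "0 < n"
  shows "(\<Sum>i<n. x i * x i) = 1"
  using assms(2) by (simp add: sign_vectors_square[OF assms(1)])

text \<open>Turns expectations over the prior into finite sums; on a finite space it is enough to
  compare singletons.\<close>

lemma iid_rademacher_eq: "iid_rademacher n = uniform_count_measure (sign_vectors n)"
proof (rule measure_eqI_finite[where A = "sign_vectors n"])
  let ?V = "{1 / sqrt (real n), - (1 / sqrt (real n))}"
  interpret prob_space "uniform_count_measure ?V" by (rule prob_space_uniform_count_measure) auto
  interpret P: product_sigma_finite "\<lambda>_. uniform_count_measure ?V"
    by (simp add: product_sigma_finite_def sigma_finite_measure_axioms)
  have "sets (iid_rademacher n) = sets (PiM {..<n} (\<lambda>_. count_space ?V))"
    unfolding iid_rademacher_def by (intro sets_PiM_cong refl sets_uniform_count_measure_count_space)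
  also have "\<dots> = sets (count_space (sign_vectors n))"
    unfolding sign_vectors_def by (subst count_space_PiM_finite) auto
  finally show "sets (iid_rademacher n) = Pow (sign_vectors n)" by simp
  fix x assume x: "x \<in> sign_vectors n"
  then have "{x} = PiE {..<n} (\<lambda>i. {x i})"
    by (subst PiE_singleton) (auto simp: sign_vectors_def PiE_def)
  then have "emeasure (iid_rademacher n) {x} = (\<Prod>i<n. emeasure (uniform_count_measure ?V) {x i})"
    unfolding iid_rademacher_def using x
    by (simp only:) (rule P.emeasure_PiM; auto simp: sets_uniform_count_measure sign_vectors_def PiE_mem)
  \<comment> \<open>Leaving \<open>card ?V\<close> unevaluated includes n = 0, where
    \<open>?V\<close> has only one element.\<close>
  also have "\<dots> = (\<Prod>i<n. ennreal (1 / card ?V))"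
    using x by (intro prod.cong refl, subst emeasure_uniform_count_measure) (auto simp: sign_vectors_def PiE_mem)
  also have "\<dots> = ennreal (1 / card (sign_vectors n))"
  proof -
    have "card (sign_vectors n) = card ?V ^ n"
      unfolding sign_vectors_def by (subst card_PiE) (simp_all only: finite_lessThan prod_constant card_lessThan)
    moreover have "(\<Prod>i<n. ennreal (1 / card ?V)) = ennreal (\<Prod>i<n. 1 / card ?V)"
      by (rule prod_ennreal) simp
    ultimately show ?thesis by (simp only: prod_constant card_lessThan power_one_over of_nat_power)
  qed
  also have "\<dots> = emeasure (uniform_count_measure (sign_vectors n)) {x}"
    using x by (subst emeasure_uniform_count_measure) auto
  finally show "emeasure (iid_rademacher n) {x} = emeasure (uniform_count_measure (sign_vectors n)) {x}" .
qed (simp_all add: sets_uniform_count_measure)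

lemma nn_integral_iid_rademacher:
  "(\<integral>\<^sup>+ x. f x \<partial>iid_rademacher n) = (\<Sum>x\<in>sign_vectors n. ennreal (1 / 2 ^ n) * f x)"
  unfolding iid_rademacher_eq uniform_count_measure_def
  by (subst nn_integral_point_measure_finite) (auto simp: card_sign_vectors)

text \<open>For fixed \<open>x\<close>, the vector \<open>x'\<close> is determined by the set \<open>K\<close> of positions where it agrees with \<open>x\<close>,
  and the inner product of the two is \<open>(2 \<bar>K\<bar> - n) / n\<close>.\<close>

lemma sum_sign_vectors_inner:
  fixes h :: "real \<Rightarrow> real"
  assumes n: "0 < n" and x: "x \<in> sign_vectors n"
  shows "(\<Sum>x'\<in>sign_vectors n. h (\<Sum>i<n. x i * x' i))
    = (\<Sum>k\<le>n. real (n choose k) * h ((2 * real k - real n) / real n))"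
proof -
  define \<phi> where "\<phi> K = (\<lambda>i\<in>{..<n}. if i \<in> K then x i else - x i)" for K
  have xi: "x i = 1 / sqrt (real n) \<or> x i = - (1 / sqrt (real n))" if "i < n" for i
    using PiE_mem[OF x[unfolded sign_vectors_def], of i] that by auto
  have ne: "x i \<noteq> 0" if "i < n" for i using xi[OF that] n by auto
  have inner: "(\<Sum>i<n. x i * \<phi> K i) = (2 * real (card K) - real n) / real n" if K: "K \<subseteq> {..<n}" for K
  proof -
    have "(\<Sum>i<n. x i * \<phi> K i) = (\<Sum>i<n. (if i \<in> K then 2 / real n else 0) - 1 / real n)"
      by (intro sum.cong) (auto simp: \<phi>_def sign_vectors_square[OF x])
    also have "\<dots> = (\<Sum>i<n. if i \<in> K then 2 / real n else 0) - 1"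
      using n by (simp add: sum_subtractf)
    also have "(\<Sum>i<n. if i \<in> K then 2 / real n else 0) = (\<Sum>i\<in>{..<n} \<inter> K. 2 / real n)"
      by (rule sum.inter_restrict[symmetric]) simp
    also have "{..<n} \<inter> K = K" using K by blast
    finally show ?thesis using n by (simp add: field_simps)
  qed
  have "(\<Sum>x'\<in>sign_vectors n. h (\<Sum>i<n. x i * x' i)) = (\<Sum>K\<in>Pow {..<n}. h (\<Sum>i<n. x i * \<phi> K i))"
  proof (rule sum.reindex_bij_witness[where i = \<phi> and j = "\<lambda>x'. {i \<in> {..<n}. x' i = x i}"])
    fix x' assume x': "x' \<in> sign_vectors n"
    have x'i: "x' i = 1 / sqrt (real n) \<or> x' i = - (1 / sqrt (real n))" if "i < n" for i
      using PiE_mem[OF x'[unfolded sign_vectors_def], of i] that by auto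
    have ext: "x' i = undefined" if "\<not> i < n" for i
      using x' that by (auto simp: sign_vectors_def PiE_def extensional_def)
    show "\<phi> {i \<in> {..<n}. x' i = x i} = x'"
    proof
      fix i show "\<phi> {i \<in> {..<n}. x' i = x i} i = x' i"
        using xi[of i] x'i[of i] ext[of i] by (cases "i < n") (auto simp: \<phi>_def)
    qed
    then show "h (\<Sum>i<n. x i * \<phi> {i \<in> {..<n}. x' i = x i} i) = h (\<Sum>i<n. x i * x' i)" by simp
  next
    fix K assume "K \<in> Pow {..<n}"
    then show "{i \<in> {..<n}. \<phi> K i = x i} = K" using ne by (auto simp: \<phi>_def split: if_splits)
    have "(if i \<in> K then x i else - x i) \<in> {1 / sqrt (real n), - (1 / sqrt (real n))}" if "i < n" for i
      using xi[OF that] by auto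
    then show "\<phi> K \<in> sign_vectors n" by (auto simp only: \<phi>_def sign_vectors_def restrict_PiE_iff lessThan_iff)
  qed auto
  also have "\<dots> = (\<Sum>K\<in>Pow {..<n}. h ((2 * real (card K) - real n) / real n))"
    by (intro sum.cong) (auto simp: inner)
  also have "\<dots> = (\<Sum>k\<le>n. \<Sum>K\<in>{K \<in> Pow {..<n}. card K = k}. h ((2 * real (card K) - real n) / real n))"
  proof (rule sum.group[symmetric])
    show "card ` Pow {..<n} \<subseteq> {..n}"
      using card_mono[of "{..<n}"] by auto
  qed auto
  also have "\<dots> = (\<Sum>k\<le>n. real (n choose k) * h ((2 * real k - real n) / real n))"
  proof (intro sum.cong refl)
    fix k
    have "card {K \<in> Pow {..<n}. card K = k} = n choose k"
      using n_subsets[of "{..<n}" k] by simp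
    then show "(\<Sum>K\<in>{K \<in> Pow {..<n}. card K = k}. h ((2 * real (card K) - real n) / real n))
        = real (n choose k) * h ((2 * real k - real n) / real n)" by simp
  qed
  finally show ?thesis .
qed

section \<open>The rate function of the prior\<close>

text \<open>The conditional probability given x is the same binomial tail for every x, so averaging
  over x changes nothing.\<close>

lemma measure_inner_square_ge:
  fixes t :: real
  assumes n: "0 < n"
  shows "measure (iid_rademacher n \<Otimes>\<^sub>M iid_rademacher n)
      {(x, x') \<in> space (iid_rademacher n \<Otimes>\<^sub>M iid_rademacher n). (\<Sum>i<n. x i * x' i)\<^sup>2 \<ge> t}
    = (\<Sum>k | k \<le> n \<and> t \<le> ((2 * real k - real n) / real n)\<^sup>2. real (n choose k)) / 2 ^ n"
    (is "measure ?M ?E = sum _ ?K / _")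
proof -
  let ?S = "sign_vectors n"
  have sp: "space (iid_rademacher n) = ?S" by (simp add: iid_rademacher_eq space_uniform_count_measure)
  interpret U: prob_space "iid_rademacher n"
    unfolding iid_rademacher_eq by (rule prob_space_uniform_count_measure) auto
  have "sets ?M = sets (count_space ?S \<Otimes>\<^sub>M count_space ?S)"
    by (intro sets_pair_measure_cong) (auto simp: iid_rademacher_eq sets_uniform_count_measure)
  then have "sets ?M = Pow (?S \<times> ?S)"
    by (subst (asm) pair_measure_count_space) simp_all
  then have E: "?E \<in> sets ?M" by (auto simp: space_pair_measure sp)
  have card: "real (card {x' \<in> ?S. t \<le> (\<Sum>i<n. x i * x' i)\<^sup>2}) = (\<Sum>k\<in>?K. real (n choose k))"
    if x: "x \<in> ?S" for x
  proof -
    have "real (card {x' \<in> ?S. t \<le> (\<Sum>i<n. x i * x' i)\<^sup>2})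
        = (\<Sum>x'\<in>?S. if t \<le> (\<Sum>i<n. x i * x' i)\<^sup>2 then 1 else 0)"
      by (simp add: sum.inter_filter[symmetric])
    also have "\<dots> = (\<Sum>k\<le>n. real (n choose k) * (if t \<le> ((2 * real k - real n) / real n)\<^sup>2 then 1 else 0))"
      by (rule sum_sign_vectors_inner[OF n x, of "\<lambda>u. if t \<le> u\<^sup>2 then 1 else 0"])
    also have "\<dots> = (\<Sum>k\<in>{k \<in> {..n}. t \<le> ((2 * real k - real n) / real n)\<^sup>2}. real (n choose k))"
      by (subst sum.inter_filter) (auto intro!: sum.cong)
    also have "{k \<in> {..n}. t \<le> ((2 * real k - real n) / real n)\<^sup>2} = ?K" by auto
    finally show ?thesis .
  qed
  let ?c = "(\<Sum>k\<in>?K. real (n choose k)) / 2 ^ n"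
  have c: "0 \<le> ?c" by (intro divide_nonneg_nonneg sum_nonneg) auto
  have "emeasure ?M ?E = (\<integral>\<^sup>+ x. emeasure (iid_rademacher n) (Pair x -` ?E) \<partial>iid_rademacher n)"
    by (rule U.emeasure_pair_measure_alt[OF E])
  also have "\<dots> = (\<Sum>x\<in>?S. ennreal (1 / 2 ^ n) * emeasure (iid_rademacher n) (Pair x -` ?E))"
    by (rule nn_integral_iid_rademacher)
  also have "\<dots> = (\<Sum>x\<in>?S. ennreal (1 / 2 ^ n) * ennreal ?c)"
  proof (intro sum.cong refl arg_cong[of _ _ "(*) (ennreal (1 / 2 ^ n))"])
    fix x assume x: "x \<in> ?S"
    then have "Pair x -` ?E = {x' \<in> ?S. t \<le> (\<Sum>i<n. x i * x' i)\<^sup>2}"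
      by (auto simp: space_pair_measure sp)
    then have "emeasure (iid_rademacher n) (Pair x -` ?E)
        = ennreal (real (card {x' \<in> ?S. t \<le> (\<Sum>i<n. x i * x' i)\<^sup>2}) / real (card ?S))"
      unfolding iid_rademacher_eq by (simp only:) (rule emeasure_uniform_count_measure; blast intro: finite_sign_vectors)
    then show "emeasure (iid_rademacher n) (Pair x -` ?E) = ennreal ?c"
      unfolding card[OF x] card_sign_vectors by simp
  qed
  also have "\<dots> = ennreal ?c"
  proof -
    have "(\<Sum>x\<in>?S. ennreal (1 / 2 ^ n) * ennreal c) = ennreal c" if "0 \<le> c" for c :: real
    proof -
      have "(\<Sum>x\<in>?S. ennreal (1 / 2 ^ n) * ennreal c) = (\<Sum>x\<in>?S. ennreal (1 / 2 ^ n * c))"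
        using that by (intro sum.cong refl ennreal_mult[symmetric]) auto
      also have "\<dots> = ennreal (\<Sum>x\<in>?S. 1 / 2 ^ n * c)"
        using that by (intro sum_ennreal) auto
      finally show ?thesis by (simp add: card_sign_vectors)
    qed
    then show ?thesis using c .
  qed
  finally show ?thesis by (rule measure_eq_emeasure_eq_ennreal[OF c])
qed

lemma rate_function_iid_rademacher:
  fixes t :: real
  assumes t: "0 < t" "t < 1"
  shows "rate_function iid_rademacher t = rademacher_rate (sqrt t)"
proof -
  define s where "s = sqrt t"
  have s: "0 < s" "s < 1" using t by (auto simp: s_def)
  define P where "P n = (\<Sum>k | k \<le> n \<and> t \<le> ((2 * real k - real n) / real n)\<^sup>2. real (n choose k)) / 2 ^ n" for n
  \<comment> \<open>For n > 0, \<open>m n\<close> is the least k with (2 k - n) / n \<ge> s, so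
    \<open>\<sigma> n\<close> is the lattice point just above s. Its single binomial term gives the
    lower bound for the tail.\<close>
  define m where "m n = nat \<lceil>real n * (1 + s) / 2\<rceil>" for n
  define \<sigma> where "\<sigma> n = (2 * real (m n) - real n) / real n" for n
  have ge: "t \<le> ((2 * real k - real n) / real n)\<^sup>2 \<longleftrightarrow> s * real n \<le> \<bar>2 * real k - real n\<bar>" if "0 < n" for n k
  proof -
    have "t = s\<^sup>2" using t by (simp add: s_def)
    then have "t \<le> ((2 * real k - real n) / real n)\<^sup>2 \<longleftrightarrow> s \<le> \<bar>(2 * real k - real n) / real n\<bar>"
      using s abs_le_square_iff[of s "(2 * real k - real n) / real n"] by simp
    then show ?thesis using that by (simp add: pos_le_divide_eq)
  qed
  have m: "m n \<le> n" "s \<le> \<sigma> n" "\<sigma> n \<le> s + 2 / real n" if n: "0 < n" for n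
  proof -
    have "real n * (1 + s) \<le> real n * 2" using s by (intro mult_left_mono) auto
    then have "real n * (1 + s) / 2 \<le> real n" by simp
    then show "m n \<le> n" by (simp add: m_def ceiling_le_iff)
    have "0 \<le> real n * (1 + s) / 2" using s by simp
    then have "real n * (1 + s) / 2 \<le> real (m n)" "real (m n) \<le> real n * (1 + s) / 2 + 1"
      unfolding m_def by linarith+
    then have "s * real n \<le> 2 * real (m n) - real n" "2 * real (m n) - real n \<le> s * real n + 2"
      by (simp_all add: distrib_left mult.commute field_split_simps)
    from this[THEN divide_right_mono, of "real n"] show "s \<le> \<sigma> n" "\<sigma> n \<le> s + 2 / real n"
      using n unfolding \<sigma>_def by (simp_all add: add_divide_distrib)
  qed
  have upper: "P n \<le> 2 * exp (- real n * rademacher_rate s)" if n: "0 < n" for n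
    using binomial_tail_le[of s n] s unfolding P_def ge[OF n] by (simp add: pos_divide_le_eq mult_ac)
  have lower: "exp (- real n * rademacher_rate (\<sigma> n)) / real (n + 1) \<le> P n" if n: "0 < n" for n
  proof -
    have "exp (- real n * rademacher_rate (\<sigma> n)) / real (n + 1) \<le> real (n choose m n) / 2 ^ n"
      unfolding \<sigma>_def by (rule binomial_ge_exp_rate[OF m(1)[OF n] n])
    also have "\<dots> \<le> P n"
      unfolding P_def
    proof (intro divide_right_mono member_le_sum)
      have "s * real n \<le> \<bar>2 * real (m n) - real n\<bar>"
        using m(2)[OF n] n by (simp add: \<sigma>_def pos_le_divide_eq)
      then show "m n \<in> {k. k \<le> n \<and> t \<le> ((2 * real k - real n) / real n)\<^sup>2}"
        using m(1)[OF n] ge[OF n] by simp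
    qed auto
    finally show ?thesis .
  qed
  have bounds: "rademacher_rate s - ln 2 / real n \<le> - (1 / real n) * ln (P n)"
    "- (1 / real n) * ln (P n) \<le> rademacher_rate (\<sigma> n) + ln (real (n + 1)) / real n" if n: "0 < n" for n
  proof -
    have pos: "0 < P n" by (rule less_le_trans[OF _ lower[OF n]]) simp
    have "ln (P n) \<le> ln (2 * exp (- real n * rademacher_rate s))"
      using upper[OF n] pos by simp
    also have "\<dots> = ln 2 - real n * rademacher_rate s" by (simp add: ln_mult)
    finally have "(real n * rademacher_rate s - ln 2) / real n \<le> - ln (P n) / real n"
      by (intro divide_right_mono) auto
    then show "rademacher_rate s - ln 2 / real n \<le> - (1 / real n) * ln (P n)"
      using n by (simp add: diff_divide_distrib)
    have "ln (exp (- real n * rademacher_rate (\<sigma> n)) / real (n + 1)) \<le> ln (P n)"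
      using lower[OF n] pos by simp
    then have "- real n * rademacher_rate (\<sigma> n) - ln (real (n + 1)) \<le> ln (P n)"
      by (simp add: ln_div)
    then have "- ln (P n) / real n \<le> (real n * rademacher_rate (\<sigma> n) + ln (real (n + 1))) / real n"
      by (intro divide_right_mono) auto
    then show "- (1 / real n) * ln (P n) \<le> rademacher_rate (\<sigma> n) + ln (real (n + 1)) / real n"
      using n by (simp add: add_divide_distrib)
  qed
  have ev: "\<forall>\<^sub>F n :: nat in sequentially. 0 < n" by (rule eventually_gt_at_top)
  have "\<sigma> \<longlonglongrightarrow> s"
  proof (rule tendsto_sandwich)
    show "\<forall>\<^sub>F n in sequentially. s \<le> \<sigma> n" "\<forall>\<^sub>F n in sequentially. \<sigma> n \<le> s + 2 / real n"
      using ev by (rule eventually_mono; use m in blast)+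
    show "(\<lambda>n. s + 2 / real n) \<longlonglongrightarrow> s" by real_asymp
  qed simp
  moreover have "isCont rademacher_rate s"
    unfolding rademacher_rate_def using s by (intro continuous_intros) auto
  ultimately have "(\<lambda>n. rademacher_rate (\<sigma> n)) \<longlonglongrightarrow> rademacher_rate s"
    by (rule isCont_tendsto_compose[rotated])
  then have up: "(\<lambda>n. rademacher_rate (\<sigma> n) + ln (real (n + 1)) / real n) \<longlonglongrightarrow> rademacher_rate s + 0"
    by (rule tendsto_add) real_asymp
  have "(\<lambda>n. - (1 / real n) * ln (P n)) \<longlonglongrightarrow> rademacher_rate s"
  proof (rule tendsto_sandwich)
    show "\<forall>\<^sub>F n in sequentially. rademacher_rate s - ln 2 / real n \<le> - (1 / real n) * ln (P n)"
      "\<forall>\<^sub>F n in sequentially. - (1 / real n) * ln (P n) \<le> rademacher_rate (\<sigma> n) + ln (real (n + 1)) / real n"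
      using ev by (rule eventually_mono; use bounds in blast)+
    show "(\<lambda>n. rademacher_rate s - ln 2 / real n) \<longlonglongrightarrow> rademacher_rate s" by real_asymp
  qed (use up in simp)
  \<comment> \<open>The probability is known to equal \<open>P n\<close> only for n > 0, which is
    enough for the limit.\<close>
  moreover have "\<forall>\<^sub>F n in sequentially. - (1 / real n) * ln (P n) = - (1 / real n) *
     ln (measure (iid_rademacher n \<Otimes>\<^sub>M iid_rademacher n)
       {(x, x') \<in> space (iid_rademacher n \<Otimes>\<^sub>M iid_rademacher n). (\<Sum>i<n. x i * x' i)\<^sup>2 \<ge> t})"
    using ev by (rule eventually_mono) (simp add: P_def measure_inner_square_ge)
  ultimately show ?thesis
    unfolding rate_function_def s_def[symmetric]
    by (intro limI) (rule Lim_transform_eventually)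
qed

section \<open>Contiguity\<close>

text \<open>For n = 0 the sum is empty. This case matters because contiguity asks for probability
  measures at every n.\<close>

lemma sign_vectors_spike_bound:
  assumes "x \<in> sign_vectors n" "\<bar>\<beta>\<bar> < 1"
  shows "\<bar>\<beta> * (\<Sum>i<n. x i * x i)\<bar> < 1"
  using assms sign_vectors_norm[OF assms(1)] by (cases "n = 0") auto

lemma prob_space_iid_rademacher: "prob_space (iid_rademacher n)"
  unfolding iid_rademacher_eq by (rule prob_space_uniform_count_measure) auto

lemma space_iid_rademacher: "space (iid_rademacher n) = sign_vectors n"
  by (simp add: iid_rademacher_eq space_uniform_count_measure)

lemma prob_space_gram_law_spiked:
  assumes "\<bar>\<beta>\<bar> < 1" "x \<in> sign_vectors n"
  shows "prob_space (gram_law n N (spiked_covariance n \<beta> x))"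
  using assms by (intro prob_space_gram_law prob_space_mv_normal_spiked sign_vectors_spike_bound)

text \<open>The prior lives on a discrete space, so only the values have to be checked.\<close>

lemma gram_law_spiked_kernel:
  assumes "\<bar>\<beta>\<bar> < 1"
  shows "(\<lambda>x. gram_law n N (spiked_covariance n \<beta> x))
    \<in> measurable (iid_rademacher n) (subprob_algebra (PiM ({..<n} \<times> {..<n}) (\<lambda>_. borel)))"
proof -
  have "sets (iid_rademacher n) = sets (count_space (sign_vectors n))"
    by (simp add: iid_rademacher_eq sets_uniform_count_measure)
  then have "measurable (iid_rademacher n) M = measurable (count_space (sign_vectors n)) M"
    for M :: "(nat \<times> nat \<Rightarrow> real) measure measure"
    by (rule measurable_cong_sets) simp
  then show ?thesis
    using prob_space_gram_law_spiked[OF assms]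
    by (auto simp: space_subprob_algebra prob_space_imp_subprob_space)
qed

lemma sets_spiked_wishart [simp]:
  "sets (spiked_wishart N \<beta> iid_rademacher n) = sets (PiM ({..<n} \<times> {..<n}) (\<lambda>_. borel))"
  unfolding spiked_wishart_def by (rule sets_bind) (auto simp: space_iid_rademacher)

lemma prob_space_spiked_wishart:
  assumes "\<bar>\<beta>\<bar> < 1"
  shows "prob_space (spiked_wishart N \<beta> iid_rademacher n)"
  unfolding spiked_wishart_def
  by (rule prob_space.prob_space_bind[OF prob_space_iid_rademacher _ gram_law_spiked_kernel[OF assms]])
     (auto simp: space_iid_rademacher intro!: AE_I2 prob_space_gram_law_spiked assms)

lemma sets_wishart [simp]: "sets (wishart N n) = sets (PiM ({..<n} \<times> {..<n}) (\<lambda>_. borel))"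
  by (simp add: wishart_def)

lemma prob_space_wishart: "prob_space (wishart N n)"
  unfolding wishart_def by (intro prob_space_gram_law prob_space_mv_normal_standard)

lemma emeasure_spiked_wishart:
  assumes "\<bar>\<beta>\<bar> < 1" "A \<in> sets (PiM ({..<n} \<times> {..<n}) (\<lambda>_. borel))"
  shows "emeasure (spiked_wishart N \<beta> iid_rademacher n) A
    = (\<Sum>x\<in>sign_vectors n. ennreal (1 / 2 ^ n) * emeasure (gram_law n (N n) (spiked_covariance n \<beta> x)) A)"
  unfolding spiked_wishart_def
  by (subst emeasure_bind[OF _ gram_law_spiked_kernel[OF assms(1)] assms(2)])
     (auto simp: space_iid_rademacher nn_integral_iid_rademacher)

section \<open>The second moment method\<close>

lemma prod_spike_ratio_measurable:
  "(\<lambda>X. \<Prod>k<N. spike_ratio n \<beta> x (X k)) \<in> borel_measurable (PiM {..<N} (\<lambda>_. mv_normal n (1\<^sub>m n)))"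
proof (intro borel_measurable_prod)
  fix k assume "k \<in> {..<N}"
  then have "(\<lambda>X. X k) \<in> measurable (PiM {..<N} (\<lambda>_. mv_normal n (1\<^sub>m n))) (mv_normal n (1\<^sub>m n))"
    by (rule measurable_component_singleton)
  moreover have "spike_ratio n \<beta> x \<in> borel_measurable (mv_normal n (1\<^sub>m n))" by measurable
  ultimately show "(\<lambda>X. spike_ratio n \<beta> x (X k)) \<in> borel_measurable (PiM {..<N} (\<lambda>_. mv_normal n (1\<^sub>m n)))"
    by (rule measurable_compose)
qed

text \<open>The second moment of the likelihood ratio: squaring the prior average introduces two
  independent spikes x and y.\<close>

definition spike_second_moment :: "nat \<Rightarrow> nat \<Rightarrow> real \<Rightarrow> real" where
  "spike_second_moment n N \<beta> = (\<Sum>x\<in>sign_vectors n. \<Sum>y\<in>sign_vectors n.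
     1 / 2 ^ n * (1 / 2 ^ n) * (1 / sqrt (1 - \<beta>\<^sup>2 * (\<Sum>i<n. x i * y i)\<^sup>2)) ^ N)"

text \<open>With \<open>L\<close> the likelihood ratio of the two laws of \<open>X\<close>, this integrates \<open>L \<le> K + L\<^sup>2 / K\<close>
  over the preimage of \<open>A\<close>.\<close>

lemma measure_spiked_wishart_le:
  fixes K \<beta> :: real
  assumes n: "0 < n" and \<beta>: "\<bar>\<beta>\<bar> < 1" and K: "0 < K"
    and A: "A \<in> sets (PiM ({..<n} \<times> {..<n}) (\<lambda>_. borel))"
  shows "measure (spiked_wishart N \<beta> iid_rademacher n) A
    \<le> K * measure (wishart N n) A + spike_second_moment n (N n) \<beta> / K"
proof -
  let ?S = "sign_vectors n" and ?Q = "PiM {..<N n} (\<lambda>_. mv_normal n (1\<^sub>m n))"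
  define l where "l x X = (\<Prod>k<N n. spike_ratio n \<beta> x (X k))" for x X
  define L where "L X = (\<Sum>x\<in>?S. 1 / 2 ^ n * l x X)" for X
  define B where "B X = (indicator A (gram_map n (N n) X) :: ennreal)" for X
  interpret P: prob_space "spiked_wishart N \<beta> iid_rademacher n" by (rule prob_space_spiked_wishart[OF \<beta>])
  interpret W: prob_space "wishart N n" by (rule prob_space_wishart)
  have l0: "0 \<le> l x X" if "x \<in> ?S" for x X
    using sign_vectors_spike_bound[OF that \<beta>] unfolding l_def
    by (intro prod_nonneg ballI spike_ratio_nonneg) auto
  have L0: "0 \<le> L X" for X unfolding L_def by (intro sum_nonneg mult_nonneg_nonneg l0) auto
  have [measurable]: "l x \<in> borel_measurable ?Q" for x
    unfolding l_def by (rule prod_spike_ratio_measurable)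
  have [measurable]: "L \<in> borel_measurable ?Q" unfolding L_def by measurable
  have [measurable]: "B \<in> borel_measurable ?Q"
    unfolding B_def by (rule measurable_compose[OF gram_map_measurable]) (use A in measurable)
  have second: "spike_second_moment n (N n) \<beta> \<ge> 0"
    unfolding spike_second_moment_def using nn_integral_spike_ratio_mult(1)[OF _ _ \<beta>] n
    by (intro sum_nonneg mult_nonneg_nonneg zero_le_power divide_nonneg_nonneg)
       (auto simp: sign_vectors_norm less_imp_le)
  have EP: "emeasure (spiked_wishart N \<beta> iid_rademacher n) A = (\<integral>\<^sup>+ X. ennreal (L X) * B X \<partial>?Q)"
  proof -
    have "emeasure (spiked_wishart N \<beta> iid_rademacher n) A
        = (\<Sum>x\<in>?S. ennreal (1 / 2 ^ n) * (\<integral>\<^sup>+ X. ennreal (l x X) * B X \<partial>?Q))"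
      unfolding emeasure_spiked_wishart[OF \<beta> A]
      by (intro sum.cong refl arg_cong[of _ _ "(*) (ennreal (1 / 2 ^ n))"])
         (simp add: emeasure_gram_law_spiked[OF sign_vectors_spike_bound[OF _ \<beta>] A] l_def B_def)
    also have "\<dots> = (\<Sum>x\<in>?S. \<integral>\<^sup>+ X. ennreal (1 / 2 ^ n) * (ennreal (l x X) * B X) \<partial>?Q)"
      by (intro sum.cong refl nn_integral_cmult[symmetric]) measurable
    also have "\<dots> = (\<integral>\<^sup>+ X. (\<Sum>x\<in>?S. ennreal (1 / 2 ^ n) * (ennreal (l x X) * B X)) \<partial>?Q)"
      by (intro nn_integral_sum[symmetric]) measurable
    also have "\<dots> = (\<integral>\<^sup>+ X. ennreal (L X) * B X \<partial>?Q)"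
    proof (intro nn_integral_cong)
      fix X
      have "(\<Sum>x\<in>?S. ennreal (1 / 2 ^ n) * (ennreal (l x X) * B X)) = (\<Sum>x\<in>?S. ennreal (1 / 2 ^ n * l x X)) * B X"
        unfolding sum_distrib_right
        by (intro sum.cong refl) (subst ennreal_mult; simp add: l0 mult.assoc)
      also have "(\<Sum>x\<in>?S. ennreal (1 / 2 ^ n * l x X)) = ennreal (L X)"
        unfolding L_def by (rule sum_ennreal) (simp add: l0)
      finally show "(\<Sum>x\<in>?S. ennreal (1 / 2 ^ n) * (ennreal (l x X) * B X)) = ennreal (L X) * B X" .
    qed
    finally show ?thesis .
  qed
  have EQ: "(\<integral>\<^sup>+ X. B X \<partial>?Q) = emeasure (wishart N n) A"
  proof -
    have "(\<integral>\<^sup>+ X. B X \<partial>?Q) = (\<integral>\<^sup>+ Y. indicator A Y \<partial>wishart N n)"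
      unfolding wishart_def gram_law_eq_distr B_def
      by (rule nn_integral_distr[symmetric, OF gram_map_measurable]) (use A in measurable)
    then show ?thesis using A by simp
  qed
  have E2: "(\<integral>\<^sup>+ X. ennreal ((L X)\<^sup>2) \<partial>?Q) = ennreal (spike_second_moment n (N n) \<beta>)"
  proof -
    have "ennreal ((L X)\<^sup>2) = (\<Sum>x\<in>?S. \<Sum>y\<in>?S. ennreal (1 / 2 ^ n * (1 / 2 ^ n)) * ennreal (l x X * l y X))" for X
    proof -
      have "(L X)\<^sup>2 = (\<Sum>x\<in>?S. \<Sum>y\<in>?S. 1 / 2 ^ n * (1 / 2 ^ n) * (l x X * l y X))"
        unfolding L_def power2_eq_square sum_product by (intro sum.cong refl) (simp only: mult_ac)
      also have "ennreal \<dots> = (\<Sum>x\<in>?S. \<Sum>y\<in>?S. ennreal (1 / 2 ^ n * (1 / 2 ^ n) * (l x X * l y X)))"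
        by (subst sum_ennreal[symmetric], intro sum_nonneg mult_nonneg_nonneg l0; (simp; fail)?)
           (intro sum.cong refl sum_ennreal[symmetric] mult_nonneg_nonneg l0; simp)
      also have "\<dots> = (\<Sum>x\<in>?S. \<Sum>y\<in>?S. ennreal (1 / 2 ^ n * (1 / 2 ^ n)) * ennreal (l x X * l y X))"
        by (intro sum.cong refl ennreal_mult mult_nonneg_nonneg l0) auto
      finally show ?thesis .
    qed
    then have "(\<integral>\<^sup>+ X. ennreal ((L X)\<^sup>2) \<partial>?Q)
        = (\<integral>\<^sup>+ X. (\<Sum>x\<in>?S. \<Sum>y\<in>?S. ennreal (1 / 2 ^ n * (1 / 2 ^ n)) * ennreal (l x X * l y X)) \<partial>?Q)"
      by simp
    also have "\<dots> = (\<Sum>x\<in>?S. \<integral>\<^sup>+ X. (\<Sum>y\<in>?S. ennreal (1 / 2 ^ n * (1 / 2 ^ n)) * ennreal (l x X * l y X)) \<partial>?Q)"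
      by (rule nn_integral_sum) measurable
    also have "\<dots> = (\<Sum>x\<in>?S. \<Sum>y\<in>?S. \<integral>\<^sup>+ X. ennreal (1 / 2 ^ n * (1 / 2 ^ n)) * ennreal (l x X * l y X) \<partial>?Q)"
      by (intro sum.cong refl nn_integral_sum) measurable
    also have "\<dots> = (\<Sum>x\<in>?S. \<Sum>y\<in>?S. ennreal (1 / 2 ^ n * (1 / 2 ^ n)) * (\<integral>\<^sup>+ X. ennreal (l x X * l y X) \<partial>?Q))"
      by (intro sum.cong refl nn_integral_cmult) measurable
    also have "\<dots> = (\<Sum>x\<in>?S. \<Sum>y\<in>?S. ennreal (1 / 2 ^ n * (1 / 2 ^ n) * (1 / sqrt (1 - \<beta>\<^sup>2 * (\<Sum>i<n. x i * y i)\<^sup>2)) ^ N n))"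
    proof (intro sum.cong refl)
      fix x y assume xy: "x \<in> ?S" "y \<in> ?S"
      note norm = sign_vectors_norm[OF xy(1) n] sign_vectors_norm[OF xy(2) n]
      have "\<beta>\<^sup>2 * (\<Sum>i<n. x i * y i)\<^sup>2 < 1" by (rule nn_integral_spike_ratio_mult(1)[OF norm \<beta>])
      then have "0 \<le> (1 / sqrt (1 - \<beta>\<^sup>2 * (\<Sum>i<n. x i * y i)\<^sup>2)) ^ N n" by simp
      then show "ennreal (1 / 2 ^ n * (1 / 2 ^ n)) * (\<integral>\<^sup>+ X. ennreal (l x X * l y X) \<partial>?Q)
          = ennreal (1 / 2 ^ n * (1 / 2 ^ n) * (1 / sqrt (1 - \<beta>\<^sup>2 * (\<Sum>i<n. x i * y i)\<^sup>2)) ^ N n)"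
        unfolding l_def nn_integral_prod_spike_ratio_mult[OF norm \<beta>] by (intro ennreal_mult[symmetric]) auto
    qed
    also have "\<dots> = ennreal (spike_second_moment n (N n) \<beta>)"
    proof -
      have nonneg: "0 \<le> 1 / 2 ^ n * (1 / 2 ^ n) * (1 / sqrt (1 - \<beta>\<^sup>2 * (\<Sum>i<n. x i * y i)\<^sup>2)) ^ N n"
        if "x \<in> ?S" "y \<in> ?S" for x y
        using nn_integral_spike_ratio_mult(1)[OF sign_vectors_norm[OF that(1) n] sign_vectors_norm[OF that(2) n] \<beta>]
        by simp
      show ?thesis
        unfolding spike_second_moment_def
        by (subst sum_ennreal[symmetric], intro sum_nonneg nonneg, assumption+)
           (intro sum.cong refl sum_ennreal nonneg, assumption+)
    qed
    finally show ?thesis .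
  qed
  have "ennreal (measure (spiked_wishart N \<beta> iid_rademacher n) A) = (\<integral>\<^sup>+ X. ennreal (L X) * B X \<partial>?Q)"
    using EP by (simp add: P.emeasure_eq_measure)
  \<comment> \<open>Only the term with K keeps the indicator; the quadratic term is integrated over
    the whole space.\<close>
  also have "\<dots> \<le> (\<integral>\<^sup>+ X. ennreal K * B X + ennreal (1 / K) * ennreal ((L X)\<^sup>2) \<partial>?Q)"
  proof (intro nn_integral_mono)
    fix X
    have "0 \<le> (K - L X)\<^sup>2 + K * L X" using L0[of X] K by simp
    then have "L X \<le> K + 1 / K * (L X)\<^sup>2"
      using K by (simp add: field_simps power2_eq_square)
    then have "ennreal (L X) \<le> ennreal K + ennreal (1 / K) * ennreal ((L X)\<^sup>2)"
      using K by (simp flip: ennreal_plus ennreal_mult)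
    then show "ennreal (L X) * B X \<le> ennreal K * B X + ennreal (1 / K) * ennreal ((L X)\<^sup>2)"
      by (auto simp: B_def indicator_def)
  qed
  also have "\<dots> = ennreal K * emeasure (wishart N n) A + ennreal (1 / K) * ennreal (spike_second_moment n (N n) \<beta>)"
    by (subst nn_integral_add, measurable) (simp add: nn_integral_cmult EQ E2)
  also have "\<dots> = ennreal (K * measure (wishart N n) A + spike_second_moment n (N n) \<beta> / K)"
    using K second by (simp add: W.emeasure_eq_measure flip: ennreal_plus ennreal_mult)
  finally show ?thesis
    using K second by (subst (asm) ennreal_le_iff) auto
qed

text \<open>Each summand is at most exp (c n I \<bar>\<rho>\<bar>) with c = \<beta>^2 / g < 1, and
  the resulting bound depends on neither n nor N.\<close>

lemma spike_second_moment_le: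
  fixes \<beta> g :: real
  assumes n: "0 < n" and \<beta>: "\<beta>\<^sup>2 \<le> 1 / 3" and g: "\<beta>\<^sup>2 < g" and N: "real N \<le> real n / g"
  shows "spike_second_moment n N \<beta> \<le> 2 * exp (\<beta>\<^sup>2 / g) / (1 - exp (\<beta>\<^sup>2 / g - 1))"
proof -
  let ?h = "\<lambda>u. (1 / sqrt (1 - \<beta>\<^sup>2 * u\<^sup>2)) ^ N"
  let ?I = "\<lambda>k. rademacher_rate (\<bar>2 * real k - real n\<bar> / real n)"
  have g0: "0 < g" using g by (smt (verit) zero_le_power2)
  have h: "?h ((2 * real k - real n) / real n) \<le> exp (\<beta>\<^sup>2 / g * (real n * ?I k))" if k: "k \<le> n" for k
  proof -
    define u where "u = \<bar>2 * real k - real n\<bar> / real n"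
    have u: "0 \<le> u" "u \<le> 1" using k n by (auto simp: u_def pos_divide_le_eq)
    have u2: "((2 * real k - real n) / real n)\<^sup>2 = u\<^sup>2" by (simp add: u_def power_divide)
    have "\<beta>\<^sup>2 * u\<^sup>2 \<le> 1 / 3 * 1" using u \<beta> by (intro mult_mono) (auto simp: power_le_one)
    then have pos: "0 < 1 - \<beta>\<^sup>2 * u\<^sup>2" by simp
    \<comment> \<open>This sign allows N in the exponent to be replaced by the larger n / g.\<close>
    have ln: "0 \<le> - ln (1 - \<beta>\<^sup>2 * u\<^sup>2)" using pos by (simp add: ln_le_zero_iff)
    have "1 / sqrt (1 - \<beta>\<^sup>2 * u\<^sup>2) = exp (- ln (1 - \<beta>\<^sup>2 * u\<^sup>2) / 2)"
    proof -
      have "exp (ln (1 - \<beta>\<^sup>2 * u\<^sup>2) / 2) = sqrt (1 - \<beta>\<^sup>2 * u\<^sup>2)"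
        unfolding ln_sqrt[OF less_imp_le[OF pos], symmetric] using pos by (intro exp_ln) simp
      then show ?thesis by (simp only: minus_divide_left[symmetric] exp_minus inverse_eq_divide)
    qed
    then have "?h u = exp (real N * (- ln (1 - \<beta>\<^sup>2 * u\<^sup>2) / 2))"
      by (simp only: exp_of_nat_mult)
    also have "\<dots> \<le> exp (real n / g * (- ln (1 - \<beta>\<^sup>2 * u\<^sup>2) / 2))"
      unfolding exp_le_cancel_iff using N ln by (intro mult_right_mono) auto
    also have "\<dots> = exp (real n * (- ln (1 - \<beta>\<^sup>2 * u\<^sup>2) / (2 * g)))" by simp
    also have "\<dots> \<le> exp (real n * (\<beta>\<^sup>2 / g * rademacher_rate u))"
      unfolding exp_le_cancel_iff by (intro mult_left_mono scaled_ln_le_rademacher_rate g0 \<beta> u) auto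
    also have "real n * (\<beta>\<^sup>2 / g * rademacher_rate u) = \<beta>\<^sup>2 / g * (real n * rademacher_rate u)"
      by (rule mult.left_commute)
    finally show ?thesis unfolding u2 unfolding u_def .
  qed
  have "spike_second_moment n N \<beta>
      = (\<Sum>x\<in>sign_vectors n. 1 / 2 ^ n * (1 / 2 ^ n) * (\<Sum>y\<in>sign_vectors n. ?h (\<Sum>i<n. x i * y i)))"
    by (simp only: spike_second_moment_def sum_distrib_left)
  also have "\<dots> = (\<Sum>x\<in>sign_vectors n. 1 / 2 ^ n * (1 / 2 ^ n) *
      (\<Sum>k\<le>n. real (n choose k) * ?h ((2 * real k - real n) / real n)))"
    by (intro sum.cong refl arg_cong[of _ _ "(*) (1 / 2 ^ n * (1 / 2 ^ n))"] sum_sign_vectors_inner n)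
  \<comment> \<open>The inner sum is the same for all 2^n spikes x, which cancels one normalising
    factor.\<close>
  also have "\<dots> = 1 / 2 ^ n * (\<Sum>k\<le>n. real (n choose k) * ?h ((2 * real k - real n) / real n))"
    by (simp add: card_sign_vectors)
  also have "\<dots> \<le> 1 / 2 ^ n * (\<Sum>k\<le>n. real (n choose k) * exp (\<beta>\<^sup>2 / g * (real n * ?I k)))"
    by (intro mult_left_mono sum_mono h) auto
  also have "\<dots> \<le> 1 / 2 ^ n * (2 ^ n * (2 * exp (\<beta>\<^sup>2 / g) / (1 - exp (\<beta>\<^sup>2 / g - 1))))"
    using g g0 by (intro mult_left_mono binomial_exp_rate_moment_le n) auto
  finally show ?thesis by simp
qed

lemma spiked_wishart_contiguous:
  fixes \<gamma> \<beta> :: real and N :: "nat \<Rightarrow> nat"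
  assumes \<gamma>: "\<gamma> \<le> 1 / 3" "\<beta>\<^sup>2 < \<gamma>" and N: "(\<lambda>n. real n / real (N n)) \<longlonglongrightarrow> \<gamma>"
  shows "contiguous_to (spiked_wishart N \<beta> iid_rademacher) (wishart N)"
proof -
  have \<beta>2: "\<beta>\<^sup>2 \<le> 1 / 3" using \<gamma> by simp
  then have \<beta>: "\<bar>\<beta>\<bar> < 1" by (simp flip: abs_square_less_1)
  \<comment> \<open>Since n / N n only tends to \<gamma>, the bound N n \<le> n / \<gamma> may fail
    for all n; with g < \<gamma> in its place it holds eventually.\<close>
  obtain g where g: "\<beta>\<^sup>2 < g" "g < \<gamma>" using dense[OF \<gamma>(2)] by blast
  have g0: "0 < g" using g(1) by (smt (verit) zero_le_power2)
  define C where "C = 2 * exp (\<beta>\<^sup>2 / g) / (1 - exp (\<beta>\<^sup>2 / g - 1))"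
  have C: "0 < C" using g g0 by (simp add: C_def)
  have ev: "\<forall>\<^sub>F n in sequentially. 0 < n \<and> real (N n) \<le> real n / g"
    using order_tendstoD(1)[OF N g(2)] eventually_gt_at_top[of 0]
  proof eventually_elim
    case (elim n)
    \<comment> \<open>For N n = 0 the quotient n / N n would be 0, which is not above g.\<close>
    then have "0 < real (N n)" using g0 by (cases "N n = 0") auto
    with elim show ?case using g0 by (simp add: field_simps)
  qed
  show ?thesis
    unfolding contiguous_to_def
  proof (intro conjI allI impI)
    fix n
    show "prob_space (spiked_wishart N \<beta> iid_rademacher n)" by (rule prob_space_spiked_wishart[OF \<beta>])
    show "prob_space (wishart N n)" by (rule prob_space_wishart)
    show "sets (spiked_wishart N \<beta> iid_rademacher n) = sets (wishart N n)" by simp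
  next
    fix A assume A: "\<forall>n. A n \<in> sets (wishart N n)"
      and lim: "(\<lambda>n. measure (wishart N n) (A n)) \<longlonglongrightarrow> 0"
    show "(\<lambda>n. measure (spiked_wishart N \<beta> iid_rademacher n) (A n)) \<longlonglongrightarrow> 0"
    proof (rule tendstoI)
      fix e :: real assume e: "0 < e"
      \<comment> \<open>Chosen so that the second moment contributes e / 2; with K fixed, the
        unspiked probability eventually contributes less than e / 2.\<close>
      define K where "K = 2 * C / e"
      have K: "0 < K" using C e by (simp add: K_def)
      have "\<forall>\<^sub>F n in sequentially. measure (wishart N n) (A n) < e / (2 * K)"
        using order_tendstoD(2)[OF lim] e K by simp
      with ev show "\<forall>\<^sub>F n in sequentially. dist (measure (spiked_wishart N \<beta> iid_rademacher n) (A n)) 0 < e"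
      proof eventually_elim
        case (elim n)
        have "measure (spiked_wishart N \<beta> iid_rademacher n) (A n)
            \<le> K * measure (wishart N n) (A n) + spike_second_moment n (N n) \<beta> / K"
          using elim A by (intro measure_spiked_wishart_le \<beta> K) auto
        also have "spike_second_moment n (N n) \<beta> / K \<le> C / K"
          unfolding C_def using elim K by (intro divide_right_mono spike_second_moment_le \<beta>2 g) auto
        also have "C / K = e / 2" using C e by (simp add: K_def)
        also have "K * measure (wishart N n) (A n) < K * (e / (2 * K))"
          using elim K by (intro mult_strict_left_mono) auto
        also have "K * (e / (2 * K)) = e / 2" using K by simp
        finally show ?case by simp
      qed
    qed
  qed
qed

theorem proposition5p8:
  fixes \<gamma> \<beta> :: real and N :: "nat \<Rightarrow> nat"
  assumes "0 < \<gamma>" and "\<gamma> \<le> 1 / 3" and "\<beta>\<^sup>2 < \<gamma>"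
    and "(\<lambda>n. real n / real (N n)) \<longlonglongrightarrow> \<gamma>"
  shows "(\<forall>t\<in>{0<..<1}. rate_function iid_rademacher t > -1 / (2 * \<gamma>) * ln (1 - \<beta>\<^sup>2 * t)) \<and>
         contiguous_to (spiked_wishart N \<beta> iid_rademacher) (wishart N)"
proof (intro conjI ballI)
  fix t :: real assume "t \<in> {0<..<1}"
  then have t: "0 < t" "t < 1" by auto
  then have s: "0 < sqrt t" "sqrt t \<le> 1" by auto
  have "-1 / (2 * \<gamma>) * ln (1 - \<beta>\<^sup>2 * t) = - ln (1 - \<beta>\<^sup>2 * (sqrt t)\<^sup>2) / (2 * \<gamma>)"
    using t by simp
  also have "\<dots> \<le> \<beta>\<^sup>2 / \<gamma> * rademacher_rate (sqrt t)"
    using assms s by (intro scaled_ln_le_rademacher_rate) auto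
  \<comment> \<open>Strict because \<beta>^2 < \<gamma> and the rate is positive at sqrt t >
    0.\<close>
  also have "\<dots> < 1 * rademacher_rate (sqrt t)"
    using assms s by (intro mult_strict_right_mono rademacher_rate_pos) auto
  finally show "rate_function iid_rademacher t > -1 / (2 * \<gamma>) * ln (1 - \<beta>\<^sup>2 * t)"
    using rate_function_iid_rademacher[OF t] by simp
qed (rule spiked_wishart_contiguous[OF assms(2-4)])

end
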